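(* Let $G$ be a finite simple undirected graph that is $P_5$-free and has maximum degree $\Delta(G) \ge 9$. Then $\chi(G) \le \max\{\Delta(G)-1, \omega(G)\}$.
   Context: All graphs are finite, simple and undirected. For a graph $G$: $\Delta(G)$ is the maximum degree, $\omega(G)$ the size of a maximum clique, $\chi(G)$ the chromatic number. $P_5$ denotes the path on $5$ vertices. A graph is $H$-free if it has no induced subgraph isomorphic to $H$. *)

theory Defs
  imports "Graph_Theory.Digraph_Isomorphism"
begin

text \<open>
  Finite simple undirected graphs are the library's \<^locale>\<open>graph\<close>: finite symmetric digraphs
  without loops and parallel arcs.  An undirected edge is thus a pair of opposite arcs, so the
  degree of a vertex is its \<^const>\<open>out_degree\<close> (which counts every incident edge once).
\<close>

definition max_degree :: "('a, 'b) pre_digraph \<Rightarrow> nat" where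
  "max_degree G = Max (insert 0 (out_degree G ` verts G))"  \<comment> \<open>0 for the null graph\<close>

definition clique :: "('a, 'b) pre_digraph \<Rightarrow> 'a set \<Rightarrow> bool" where
  "clique G K \<longleftrightarrow> K \<subseteq> verts G \<and> (\<forall>u\<in>K. \<forall>v\<in>K. u \<noteq> v \<longrightarrow> u \<rightarrow>\<^bsub>G\<^esub> v)"

definition clique_number :: "('a, 'b) pre_digraph \<Rightarrow> nat" where
  "clique_number G = Max (card ` {K. clique G K})"

definition proper_colouring :: "('a, 'b) pre_digraph \<Rightarrow> nat \<Rightarrow> ('a \<Rightarrow> nat) \<Rightarrow> bool" where
  "proper_colouring G k c \<longleftrightarrow>
     c ` verts G \<subseteq> {..<k} \<and> (\<forall>u v. u \<rightarrow>\<^bsub>G\<^esub> v \<longrightarrow> c u \<noteq> c v)"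

definition chromatic_number :: "('a, 'b) pre_digraph \<Rightarrow> nat" where
  "chromatic_number G = (LEAST k. \<exists>c. proper_colouring G k c)"

definition path_graph :: "nat \<Rightarrow> nat pair_pre_digraph" where
  "path_graph n =
     \<lparr> pverts = {..<n}, parcs = {(i, j). i < n \<and> j < n \<and> (j = Suc i \<or> i = Suc j)} \<rparr>"

definition induced_free :: "('a, 'b) pre_digraph \<Rightarrow> ('c, 'd) pre_digraph \<Rightarrow> bool" where
  "induced_free G H \<longleftrightarrow> \<not> (\<exists>H'. induced_subgraph H' G \<and> digraph_iso H' H)"

end

theory Submission
  imports Defs
begin

text \<open>
  Put \<open>k = max (\<Delta> - 1) \<omega>\<close>.  Then \<open>k \<ge> 8\<close>, all degrees are at most \<open>k + 1\<close> and all cliques have at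
  most \<open>k\<close> vertices, so it suffices that a \<open>P\<^sub>5\<close>-free graph with these bounds is \<open>k\<close>-colourable.  In a
  vertex-minimal counterexample the graph minus any vertex \<open>v\<close> has a \<open>k\<close>-colouring; \<open>v\<close> is the hole
  of that colouring.  The neighbours of \<open>v\<close> carry all \<open>k\<close> colours, hence at least \<open>k - 1\<close> of them are
  lone, that is, the only neighbour of \<open>v\<close> in their colour.  The hole can be moved to any lone
  neighbour, so a lone neighbour sees every colour but its own, and at most one of them twice.

  The core is that two lone neighbours \<open>p\<close>, \<open>q\<close> are always adjacent (\<open>lone_adjacent\<close>).  Otherwise
  their two colours form a Kempe chain joining them, and since there is no induced \<open>P\<^sub>5\<close> the chain
  consists of paths \<open>p a b q\<close>, which close up with \<open>v\<close> to induced five-cycles.  A lone neighbour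
  adjacent to both \<open>p\<close> and \<open>q\<close> allows a recolouring unless \<open>p\<close> or \<open>q\<close> sees its colour twice
  (\<open>common_lone\<close>); one that misses \<open>p\<close> or \<open>q\<close> must attach to \<open>a\<close> or \<open>b\<close> (\<open>five_cycle_attach\<close>) and then
  forces \<open>a\<close> or \<open>b\<close> to see its colour twice (\<open>off_side_repeats\<close>, \<open>twisted_repeats\<close>).  Each of \<open>p\<close>, \<open>q\<close>,
  \<open>a\<close>, \<open>b\<close> has room for only one such colour, so there are at most \<open>2 + 4 = 6\<close> lone neighbours, fewer
  than \<open>k - 1\<close>; if \<open>p\<close> or \<open>q\<close> sees the other's colour twice, the same charging leaves even less room.
  This is tight: in the blow-up of \<open>C\<^sub>5\<close> by triangles, where \<open>k = 7\<close>, there are six.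

  So a vertex together with its lone neighbours is a clique.  By the bound on cliques all degrees
  are \<open>k + 1\<close>, exactly two neighbours of a hole share a colour, and every hole lies in a
  \<open>k\<close>-clique \<open>K\<close>.  Excluding \<open>K\<^sub>k\<^sub>+\<^sub>1\<close> minus an edge (\<open>clique_joined_adjacent\<close>) makes the set \<open>T\<close> of outer
  neighbours of \<open>K\<close> monochromatic in every colouring (\<open>clique_boundary_monochromatic\<close>), so no vertex
  of \<open>T\<close> can be recoloured and each has at most two neighbours in \<open>K\<close>; thus \<open>T\<close> has at least \<open>k\<close>
  vertices.  By \<open>P\<^sub>5\<close>-freeness an outer neighbour \<open>w\<close> of a vertex \<open>t\<close> of \<open>T\<close> is adjacent to nearly all of
  \<open>T\<close>, hence to so few other vertices that \<open>w\<close> can be recoloured; this in turn releases a colour for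
  \<open>t\<close>, a contradiction.
\<close>

section \<open>Colour counting\<close>

definition proper_on :: "('a \<Rightarrow> 'a \<Rightarrow> bool) \<Rightarrow> nat \<Rightarrow> 'a set \<Rightarrow> ('a \<Rightarrow> nat) \<Rightarrow> bool" where
  "proper_on E k X c \<longleftrightarrow> (\<forall>x\<in>X. c x < k) \<and> (\<forall>x\<in>X. \<forall>y\<in>X. E x y \<longrightarrow> c x \<noteq> c y)"

lemma proper_on_update:
  assumes "proper_on E k X c" "m < k" "\<And>x y. E x y \<Longrightarrow> E y x" "\<not> E x x"
    and "\<And>y. y \<in> X \<Longrightarrow> E x y \<Longrightarrow> c y \<noteq> m"
  shows "proper_on E k (insert x X) (c(x := m))"
  using assms unfolding proper_on_def by (auto; metis)

text \<open>
  If the colours in \<open>M\<close> survive on \<open>X - Y\<close>, then \<open>Y\<close> is pure surplus.  The counts of repeated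
  colours below are instances: \<open>Y\<close> collects duplicates, one per extra occurrence of a colour.
\<close>

lemma card_surplus:
  assumes "finite X" "Y \<subseteq> X" "M \<subseteq> f ` X" "\<And>y. y \<in> Y \<Longrightarrow> \<exists>x\<in>X - Y. f x = f y"
  shows "card Y + card M \<le> card X"
proof -
  have "M \<subseteq> f ` (X - Y)"
  proof
    fix m assume "m \<in> M"
    then obtain x where "x \<in> X" "f x = m" using assms(3) by blast
    then show "m \<in> f ` (X - Y)" using assms(4)[of x] by (cases "x \<in> Y") (auto intro: rev_image_eqI)
  qed
  then have "card M \<le> card (X - Y)"
    using assms(1) by (meson card_mono card_image_le finite_Diff finite_imageI le_trans)
  then show ?thesis
    using assms(1,2) card_Diff_subset[of Y X] card_mono[of X Y] finite_subset[of Y X] by auto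
qed

section \<open>Vertex-critical graphs and holes\<close>

text \<open>
  A minimal graph that is not \<open>k\<close>-colourable, as an adjacency relation that is empty outside \<open>V\<close>.
  The vertices of an induced \<open>P\<^sub>5\<close> are automatically distinct: any coincidence contradicts one of the
  ten listed (non-)adjacencies.
\<close>

locale critical =
  fixes V :: "'a set" and E :: "'a \<Rightarrow> 'a \<Rightarrow> bool" and k :: nat
  assumes finV: "finite V"
    and EV: "E x y \<Longrightarrow> x \<in> V"
    and sym: "E x y \<Longrightarrow> E y x"
    and irrefl: "\<not> E x x"
    and no_P5: "\<lbrakk>E a b; E b c; E c d; E d e;
        \<not> E a c; \<not> E a d; \<not> E a e; \<not> E b d; \<not> E b e; \<not> E c e\<rbrakk> \<Longrightarrow> False"
    and degree_le: "x \<in> V \<Longrightarrow> card {y. E x y} \<le> k + 1"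
    and clique_le: "K \<subseteq> V \<Longrightarrow> (\<And>x y. x \<in> K \<Longrightarrow> y \<in> K \<Longrightarrow> x \<noteq> y \<Longrightarrow> E x y) \<Longrightarrow> card K \<le> k"
    and k_ge: "8 \<le> k"
    and not_colourable: "\<not> proper_on E k V col"
    and colourable_minus: "x \<in> V \<Longrightarrow> \<exists>col. proper_on E k (V - {x}) col"
begin

lemma EV': "E x y \<Longrightarrow> y \<in> V"
  using EV sym by blast

lemma finite_nbrs [simp]: "finite {y. E x y}"
  by (rule finite_subset[OF _ finV]) (auto dest: EV')

text \<open>
  A \<open>k\<close>-colouring of the graph without \<open>v\<close>, with the extra colour \<open>k\<close> on \<open>v\<close>.  In this way \<open>c\<close> is
  proper on the whole graph and no colour below \<open>k\<close> is ever counted at the uncoloured vertex.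
\<close>

definition hole :: "'a \<Rightarrow> ('a \<Rightarrow> nat) \<Rightarrow> bool" where
  "hole v c \<longleftrightarrow> v \<in> V \<and> c v = k \<and> (\<forall>x\<in>V. x \<noteq> v \<longrightarrow> c x < k) \<and> (\<forall>x y. E x y \<longrightarrow> c x \<noteq> c y)"

definition lone :: "'a \<Rightarrow> ('a \<Rightarrow> nat) \<Rightarrow> 'a \<Rightarrow> bool" where
  "lone v c p \<longleftrightarrow> E v p \<and> (\<forall>y. E v y \<and> c y = c p \<longrightarrow> y = p)"

definition repeats :: "'a \<Rightarrow> ('a \<Rightarrow> nat) \<Rightarrow> nat \<Rightarrow> bool" where
  "repeats x c m \<longleftrightarrow> (\<exists>y y'. y \<noteq> y' \<and> E x y \<and> E x y' \<and> c y = m \<and> c y' = m)"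

definition stuck :: "('a \<Rightarrow> nat) \<Rightarrow> 'a \<Rightarrow> bool" where
  "stuck c x \<longleftrightarrow> (\<forall>m<k. m \<noteq> c x \<longrightarrow> (\<exists>y. E x y \<and> c y = m))"

lemma hole_neq: "hole v c \<Longrightarrow> E x y \<Longrightarrow> c x \<noteq> c y"
  unfolding hole_def by blast

lemma hole_less: "hole v c \<Longrightarrow> E x y \<Longrightarrow> y \<noteq> v \<Longrightarrow> c y < k"
  unfolding hole_def using EV' by blast

lemma hole_of_proper:
  assumes c: "proper_on E k (V - {v}) c" and v: "v \<in> V" shows "hole v (c(v := k))"
  unfolding hole_def
proof (intro conjI allI impI ballI)
  fix x y assume "E x y"
  then have xy: "x \<in> V" "y \<in> V" "x \<noteq> y" using EV EV' irrefl by blast+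
  have "c z \<noteq> k" if "z \<in> V - {v}" for z using c that unfolding proper_on_def by auto
  with c \<open>E x y\<close> xy show "(c(v := k)) x \<noteq> (c(v := k)) y"
    unfolding proper_on_def by auto
qed (use assms in \<open>auto simp: proper_on_def\<close>)

lemma ex_hole:
  assumes "v \<in> V" obtains c where "hole v c"
  using colourable_minus[OF assms] hole_of_proper[OF _ assms] by blast

lemma hole_sees:
  assumes "hole v c" "m < k" shows "\<exists>y. E v y \<and> c y = m"
proof (rule ccontr)
  assume no: "\<nexists>y. E v y \<and> c y = m"
  have "proper_on E k V (c(v := m))"
    unfolding proper_on_def
  proof (intro conjI ballI impI)
    fix x y assume "E x y"
    then show "(c(v := m)) x \<noteq> (c(v := m)) y"
      using assms(1) no sym[of x y] irrefl[of x] hole_neq[OF assms(1), of x y] by auto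
  qed (use assms in \<open>auto simp: hole_def\<close>)
  then show False using not_colourable by blast
qed

text \<open>
  Colouring \<open>v\<close> like \<open>p\<close> creates a conflict only at \<open>p\<close>, which can therefore become the new hole.
\<close>

lemma hole_shift:
  assumes h: "hole v c" and l: "lone v c p"
  shows "hole p (c(v := c p, p := k))"
proof -
  have vp: "E v p" "v \<noteq> p" "c p < k" "p \<in> V" "v \<in> V" "c v = k"
    using h l irrefl hole_less EV' unfolding hole_def lone_def by blast+
  show ?thesis unfolding hole_def
  proof (intro conjI allI impI ballI)
    fix x y assume "E x y"
    then show "(c(v := c p, p := k)) x \<noteq> (c(v := c p, p := k)) y"
      using h l vp sym[of x y] irrefl hole_neq[OF h, of x y] EV[of x y] EV'[of x y]
      unfolding hole_def lone_def by (auto simp: fun_upd_def split: if_splits)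
  qed (use h vp in \<open>auto simp: hole_def\<close>)
qed

lemma lone_stuck:
  assumes h: "hole v c" and l: "lone v c p"
  shows "stuck c p"
  unfolding stuck_def
proof (intro allI impI)
  fix m assume m: "m < k" "m \<noteq> c p"
  obtain y where "E p y" "(c(v := c p, p := k)) y = m"
    using hole_sees[OF hole_shift[OF h l] m(1)] by blast
  then show "\<exists>y. E p y \<and> c y = m" using m by (auto split: if_splits)
qed

lemma lone_facts:
  assumes "hole v c" "lone v c p"
  shows "E v p" "E p v" "p \<in> V" "v \<in> V" "p \<noteq> v" "c p < k" "c v = k"
  using assms irrefl hole_less EV' sym unfolding hole_def lone_def by blast+

text \<open>
  A stuck vertex has at most \<open>k + 1\<close> neighbours for \<open>k - 1\<close> colours, hence at most two duplicates; a
  neighbour of the hole loses one more place to the hole.  The set \<open>W\<close> holds the representatives that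
  keep the colours of \<open>Y\<close> visible after \<open>Y\<close> is removed.
\<close>

lemma surplus_stuck:
  assumes h: "hole v c" and x: "x \<in> V" "x \<noteq> v" and s: "stuck c x"
    and Y: "Y \<union> W \<subseteq> {y. E x y}" "Y \<inter> W = {}" "c ` Y \<subseteq> c ` W"
  shows "card Y \<le> 2" and "E x v \<Longrightarrow> card Y \<le> 1"
proof -
  have cx: "c x < k" and ck: "\<And>y. y \<in> V \<Longrightarrow> c y = k \<longleftrightarrow> y = v"
    using h x unfolding hole_def by auto
  let ?X = "{y. E x y} - {v}"
  have M: "{..<k} - {c x} \<subseteq> c ` ?X"
  proof
    fix m assume m: "m \<in> {..<k} - {c x}"
    then obtain y where "E x y" "c y = m" using s unfolding stuck_def by auto
    then show "m \<in> c ` ?X" using m h by (auto simp: hole_def)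
  qed
  have tw: "\<exists>y'. y' \<notin> Y \<and> E x y' \<and> c y' = c y" if yY: "y \<in> Y" for y
  proof -
    obtain y' where "y' \<in> W" "c y = c y'" using Y(3) yY by blast
    then show ?thesis using Y(1,2) yY by (intro exI[of _ y']) auto
  qed
  have vY: "v \<notin> Y"
  proof
    assume vY: "v \<in> Y"
    then obtain y' where y': "y' \<notin> Y" "E x y'" "c y' = c v" using tw by blast
    have "c v = k" using h unfolding hole_def by blast
    then show False using ck[OF EV'[OF y'(2)]] y' vY by auto
  qed
  have YX: "Y \<subseteq> ?X" using vY Y(1) by blast
  have "\<exists>z\<in>?X - Y. c z = c y" if yY: "y \<in> Y" for y
  proof -
    obtain y' where y': "y' \<notin> Y" "E x y'" "c y' = c y" using tw[OF yY] by blast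
    have "y \<in> V" "y \<noteq> v" using YX yY EV' by blast+
    then have "y' \<noteq> v" using y' ck[of y] h unfolding hole_def by auto
    then show ?thesis using y' by blast
  qed
  from card_surplus[OF _ YX M this] have le: "card Y + (k - 1) \<le> card ?X"
    using cx by auto
  have "card ?X \<le> card {y. E x y}" by (simp add: card_mono)
  then show "card Y \<le> 2" using le degree_le[OF x(1)] k_ge by linarith
  assume "E x v"
  then have "card ?X = card {y. E x y} - 1" by simp
  then show "card Y \<le> 1" using le degree_le[OF x(1)] k_ge by linarith
qed

lemma lone_repeats_unique:
  assumes h: "hole v c" and l: "lone v c p" and r: "repeats p c m" "repeats p c m'"
  shows "m = m'"
proof (rule ccontr)
  assume ne: "m \<noteq> m'"
  obtain y1 y2 where y: "y1 \<noteq> y2" "E p y1" "E p y2" "c y1 = m" "c y2 = m" using r(1) unfolding repeats_def by blast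
  obtain z1 z2 where z: "z1 \<noteq> z2" "E p z1" "E p z2" "c z1 = m'" "c z2 = m'" using r(2) unfolding repeats_def by blast
  note lp = lone_facts[OF h l]
  have "card {y1, z1} \<le> 1"
    by (rule surplus_stuck(2)[where W = "{y2, z2}", OF h lp(3) lp(5) lone_stuck[OF h l] _ _ _ lp(2)]) (use y z ne in auto)
  moreover have "y1 \<noteq> z1" using y z ne by auto
  ultimately show False by simp
qed

lemma lone_no_triple:
  assumes h: "hole v c" and l: "lone v c p"
    and "E p x" "E p y" "E p z" "c x = c z" "c y = c z" "x \<noteq> y" "x \<noteq> z" "y \<noteq> z"
  shows False
proof -
  note lp = lone_facts[OF h l]
  have "card {x, y} \<le> 1"
    by (rule surplus_stuck(2)[where W = "{z}", OF h lp(3) lp(5) lone_stuck[OF h l] _ _ _ lp(2)]) (use assms in auto)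
  then show False using assms by simp
qed

lemma stuck_no_three_reps:
  assumes h: "hole v c" and x: "x \<in> V" "x \<noteq> v" "stuck c x"
    and r: "repeats x c l" "repeats x c m" "repeats x c n" "l \<noteq> m" "l \<noteq> n" "m \<noteq> n"
  shows False
proof -
  obtain a a' where a: "a \<noteq> a'" "E x a" "E x a'" "c a = l" "c a' = l" using r(1) unfolding repeats_def by blast
  obtain b b' where b: "b \<noteq> b'" "E x b" "E x b'" "c b = m" "c b' = m" using r(2) unfolding repeats_def by blast
  obtain d d' where d: "d \<noteq> d'" "E x d" "E x d'" "c d = n" "c d' = n" using r(3) unfolding repeats_def by blast
  have "card {a, b, d} \<le> 2"
    by (rule surplus_stuck(1)[where W = "{a', b', d'}", OF h x]) (use a b d r in auto)
  moreover have "a \<noteq> b" "a \<noteq> d" "b \<noteq> d" using a b d r by auto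
  ultimately show False by simp
qed

lemma stuck_no_triple_and_rep:
  assumes h: "hole v c" and x: "x \<in> V" "x \<noteq> v" "stuck c x"
    and r: "repeats x c m" and t: "E x a" "E x b" "E x d" "c a = c d" "c b = c d" "a \<noteq> b" "a \<noteq> d" "b \<noteq> d" "c d \<noteq> m"
  shows False
proof -
  obtain e e' where e: "e \<noteq> e'" "E x e" "E x e'" "c e = m" "c e' = m" using r(1) unfolding repeats_def by blast
  have "card {a, b, e} \<le> 2"
    by (rule surplus_stuck(1)[where W = "{d, e'}", OF h x]) (use e t in auto)
  moreover have "a \<noteq> e" "b \<noteq> e" using e t by auto
  ultimately show False using t by simp
qed

lemma surplus_hole:
  assumes h: "hole v c"
    and Y: "Y \<union> W \<subseteq> {y. E v y}" "Y \<inter> W = {}" "c ` Y \<subseteq> c ` W"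
  shows "card Y + k \<le> card {y. E v y}"
proof -
  have "card Y + card {..<k} \<le> card {y. E v y}"
  proof (rule card_surplus[where f = c])
    show "{..<k} \<subseteq> c ` {y. E v y}" using hole_sees[OF h] by auto
    show "\<exists>z\<in>{y. E v y} - Y. c z = c y" if yY: "y \<in> Y" for y
    proof -
      obtain y' where "y' \<in> W" "c y = c y'" using Y(3) yY by blast
      then show ?thesis using Y(1,2) yY by (intro bexI[of _ y']) auto
    qed
  qed (use Y in auto)
  then show ?thesis by simp
qed

lemma others_lone:
  assumes h: "hole v c" and xy: "E v x" "E v y" "c x = c y" "x \<noteq> y"
    and z: "E v z" "z \<noteq> x" "z \<noteq> y"
  shows "lone v c z"
proof (rule ccontr)
  assume "\<not> lone v c z"
  then obtain z' where z': "E v z'" "c z' = c z" "z \<noteq> z'" using z unfolding lone_def by auto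
  have "card {x, z} + k \<le> card {y. E v y}"
  proof (cases "c z = c x")
    case True
    show ?thesis by (rule surplus_hole[where W = "{y}", OF h]) (use xy z True in auto)
  next
    case False
    show ?thesis by (rule surplus_hole[where W = "{y, z'}", OF h]) (use xy z z' False in auto)
  qed
  moreover have "v \<in> V" using h unfolding hole_def by blast
  ultimately show False using degree_le[of v] z(2) by simp
qed

lemma card_lone:
  assumes h: "hole v c" shows "k - 1 \<le> card {w. lone v c w}"
proof -
  let ?N = "{y. E v y}" and ?L = "{w. lone v c w}"
  show ?thesis
  proof (cases "?N \<subseteq> ?L")
    case True
    then have "?L = ?N" unfolding lone_def by auto
    then show ?thesis using surplus_hole[OF h, of "{}" "{}"] by simp
  next
    case False
    then obtain x y where xy: "E v x" "E v y" "c x = c y" "x \<noteq> y" unfolding lone_def by auto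
    have "card {x} + k \<le> card ?N" by (rule surplus_hole[where W = "{y}", OF h]) (use xy in auto)
    then have "k - 1 \<le> card (?N - {x, y})" using xy by simp
    also have "\<dots> \<le> card ?L"
      using others_lone[OF h xy] by (intro card_mono finite_subset[of ?L ?N]) (auto simp: lone_def)
    finally show ?thesis .
  qed
qed

end

section \<open>Two nonadjacent lone neighbours\<close>

text \<open>
  The situation to be refuted in this part.  It is symmetric in \<open>p\<close> and \<open>q\<close>, and \<open>swapped\<close> is used
  throughout to transfer facts to the other side.
\<close>

locale nonadjacent_pair = critical +
  fixes v :: 'a and c :: "'a \<Rightarrow> nat" and p q :: 'a
  assumes hole: "hole v c" and p: "lone v c p" and q: "lone v c q"
    and pq: "p \<noteq> q" and nE: "\<not> E p q"
begin

lemmas P = lone_facts[OF hole p]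
lemmas Q = lone_facts[OF hole q]

lemma nE': "\<not> E q p" using nE sym by blast

lemma colours_distinct: "c p \<noteq> c q"
  using p q pq unfolding lone_def by metis

lemma swapped: "nonadjacent_pair V E k v c q p"
  by unfold_locales (use hole p q pq nE' in auto)

text \<open>
  The set \<open>S\<close> consists of the vertices at distance at most three from \<open>p\<close> in the two colours of \<open>p\<close> and
  \<open>q\<close>.  A vertex at distance four would end an induced \<open>P\<^sub>5\<close>, so \<open>S\<close> is a full Kempe component.  It must
  contain \<open>q\<close>, since otherwise swapping the colours on \<open>S\<close> frees the colour of \<open>p\<close> for the hole.
\<close>

lemma cross: obtains a b where "E p a" "c a = c q" "E a b" "E q b" "c b = c p"
proof -
  define A where "A = {a. E p a \<and> c a = c q}"
  define B where "B = {b. c b = c p \<and> (\<exists>a\<in>A. E a b)}"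
  define A' where "A' = {a. c a = c q \<and> (\<exists>b\<in>B. E b a)}"
  define S where "S = insert p (A \<union> B \<union> A')"
  have cS: "c x = c p \<or> c x = c q" if "x \<in> S" for x
    using that unfolding S_def A_def B_def A'_def by auto
  have closed: "y \<in> S" if xS: "x \<in> S" and e: "E x y" and cy: "c y = c p \<or> c y = c q" for x y
  proof -
    have xy: "c x \<noteq> c y" using hole_neq[OF hole e] .
    consider "x = p" | "x \<in> A" | "x \<in> B" | "x \<in> A'" "x \<notin> A" using xS unfolding S_def by blast
    then show ?thesis
    proof cases
      case 4
      show ?thesis
      proof (rule ccontr)
        assume y: "y \<notin> S"
        obtain a b where ab: "a \<in> A" "E a b" "E b x" "c b = c p" "c x = c q"
          using 4 unfolding A'_def B_def by blast
        have cyp: "c y = c p" using cy xy ab by auto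
        have a: "E p a" "c a = c q" using ab unfolding A_def by auto
        have "\<not> E a y" using y cyp ab unfolding S_def B_def by auto
        moreover have "\<not> E p x" using 4 ab unfolding A_def by auto
        ultimately show False
          using no_P5[of p a b x y] a ab e cyp hole_neq[OF hole] by metis
      qed
    qed (use xS e cy xy in \<open>auto simp: S_def A_def B_def A'_def\<close>)
  qed
  have "q \<in> S"
  proof (rule ccontr)
    assume qS: "q \<notin> S"
    define c1 where "c1 x = (if x = v then c p else if x \<in> S then (if c x = c p then c q else c p) else c x)" for x
    have pS: "p \<in> S" unfolding S_def by simp
    have c1v: "c1 v = c p" unfolding c1_def by simp
    have vN: "c1 y \<noteq> c p" if "E v y" for y
      using that p q pS qS P irrefl[of v] cS[of y] colours_distinct unfolding c1_def lone_def by auto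
    have "c1 x \<noteq> c1 y" if e: "E x y" for x y
    proof (cases "x = v \<or> y = v")
      case True
      then show ?thesis using vN[of x] vN[of y] e sym[of x y] c1v by metis
    next
      case False
      then show ?thesis
        using hole_neq[OF hole e] closed[OF _ e] closed[OF _ sym[OF e]] cS[of x] cS[of y] colours_distinct
        unfolding c1_def by (auto split: if_splits)
    qed
    moreover have "c1 x < k" if "x \<in> V" for x
      using that hole P(6) Q(6) unfolding c1_def hole_def by auto
    ultimately have "proper_on E k V c1" unfolding proper_on_def by blast
    then show False using not_colourable by blast
  qed
  then have "q \<in> A'"
    using pq nE colours_distinct unfolding S_def A_def B_def by auto
  then show ?thesis using that unfolding A'_def B_def A_def using sym by blast
qed

text \<open>
  With one path \<open>p a' b' q\<close> given, a missing edge would leave the induced path \<open>a p a' b' q\<close> or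
  \<open>p a b' q b\<close>.
\<close>

lemma complete:
  assumes a: "E p a" "c a = c q" and b: "E q b" "c b = c p"
  shows "E a b"
proof -
  obtain a' b' where ab': "E p a'" "c a' = c q" "E a' b'" "E q b'" "c b' = c p" by (rule cross)
  have ne: "\<And>x y. c x = c y \<Longrightarrow> \<not> E x y" using hole_neq[OF hole] by blast
  have 1: "E a b'"
  proof (rule ccontr)
    assume "\<not> E a b'"
    then show False
      using no_P5[of a p a' b' q] a ab' sym ne nE by metis
  qed
  show ?thesis
  proof (rule ccontr)
    assume "\<not> E a b"
    then show False
      using no_P5[of p a b' q b] 1 a b ab' sym ne nE by metis
  qed
qed

lemma not_adj_hole:
  assumes "E p a" "c a = c q" shows "\<not> E v a" "\<not> E a v"
  using assms nE q sym unfolding lone_def by blast+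

lemma not_adj_hole':
  assumes "E q b" "c b = c p" shows "\<not> E v b" "\<not> E b v"
  using assms nE' p sym unfolding lone_def by blast+

text \<open>
  The vertices \<open>v, p, a, b, q\<close> form an induced five-cycle.  A further vertex adjacent to \<open>v\<close> only, or to
  \<open>v\<close> and just one of \<open>p\<close>, \<open>q\<close>, but to neither \<open>a\<close> nor \<open>b\<close>, starts an induced \<open>P\<^sub>5\<close> running around the cycle.
\<close>

lemma five_cycle_attach:
  assumes a: "E p a" "c a = c q" and b: "E q b" "c b = c p"
    and w: "E v w" "w \<noteq> p" "w \<noteq> q" and non: "\<not> (E w p \<and> E w q)"
  shows "E w a \<or> E w b"
proof (rule ccontr)
  assume no: "\<not> (E w a \<or> E w b)"
  note ab = complete[OF a b]
  have ne: "\<And>x y. c x = c y \<Longrightarrow> \<not> E x y" using hole_neq[OF hole] by blast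
  have nv: "\<not> E v a" "\<not> E v b" using not_adj_hole[OF a] not_adj_hole'[OF b] by blast+
  consider "\<not> E w p" "\<not> E w q" | "\<not> E w p" "E w q" | "E w p" "\<not> E w q" using non by blast
  then show False
  proof cases
    case 1 then show False using no_P5[of w v p a b] w P a ab no nv ne b sym by metis
  next
    case 2 then show False using no_P5[of w q b a p] w P a ab no nv ne b sym nE nE' by metis
  next
    case 3 then show False using no_P5[of w p a b q] w P a ab no nv ne b sym nE nE' by metis
  qed
qed

text \<open>
  If both \<open>p\<close> and \<open>q\<close> see the colour of \<open>w\<close> only at \<open>w\<close>, both can take that colour.  Then \<open>w\<close> takes the old
  colour of \<open>p\<close> and the hole that of \<open>q\<close>, or the other way round: as \<open>w\<close> repeats at most one colour, it
  sees \<open>p\<close> or \<open>q\<close> as the only vertex of its colour, and that colour is available to \<open>w\<close>.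
\<close>

lemma common_lone:
  assumes w: "lone v c w" and wp: "E w p" and wq: "E w q"
  shows "repeats p c (c w) \<or> repeats q c (c w)"
proof (rule ccontr)
  assume no: "\<not> (repeats p c (c w) \<or> repeats q c (c w))"
  note W = lone_facts[OF hole w]
  have lp: "\<And>y. E p y \<Longrightarrow> c y = c w \<Longrightarrow> y = w" using no wp sym unfolding repeats_def by blast
  have lq: "\<And>y. E q y \<Longrightarrow> c y = c w \<Longrightarrow> y = w" using no wq sym unfolding repeats_def by blast
  have cw: "c w \<noteq> c p" "c w \<noteq> c q" using hole_neq[OF hole] wp wq by blast+
  have wpq: "w \<noteq> p" "w \<noteq> q" using cw by auto
  have contra: False
    if r: "r \<in> {p, q}" "s \<in> {p, q}" "r \<noteq> s" and clean: "\<And>y. E w y \<Longrightarrow> c y = c r \<Longrightarrow> y = r" for r s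
  proof -
    have r': "c r < k" "c s < k" "lone v c s" "c r \<noteq> c s" using r P Q p q colours_distinct by auto
    \<comment> \<open>The vertex \<open>w\<close> is taken out first so that every single update stays proper.\<close>
    let ?c1 = "c(p := c w)" let ?c2 = "?c1(q := c w)"
    let ?c3 = "?c2(w := c r)" let ?c4 = "?c3(v := c s)"
    have "proper_on E k (V - {v, w}) c"
      using hole unfolding proper_on_def hole_def by auto
    then have "proper_on E k (insert p (V - {v, w})) ?c1"
      by (rule proper_on_update[OF _ W(6) sym irrefl]) (use lp in auto)
    then have "proper_on E k (insert q (insert p (V - {v, w}))) ?c2"
      by (rule proper_on_update[OF _ W(6) sym irrefl]) (use lq nE' in \<open>auto split: if_splits\<close>)
    then have "proper_on E k (insert w (insert q (insert p (V - {v, w})))) ?c3"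
      by (rule proper_on_update[OF _ r'(1) sym irrefl]) (use clean r cw in \<open>auto split: if_splits\<close>)
    then have "proper_on E k (insert v (insert w (insert q (insert p (V - {v, w}))))) ?c4"
    proof (rule proper_on_update[OF _ r'(2) sym irrefl])
      fix y assume y: "E v y"
      show "?c3 y \<noteq> c s"
        using y r r' cw lone_def[of v c s] by auto
    qed
    moreover have "insert v (insert w (insert q (insert p (V - {v, w})))) = V"
      using W P Q by auto
    ultimately show False using not_colourable by simp
  qed
  have "\<not> repeats w c (c p) \<or> \<not> repeats w c (c q)"
    using lone_repeats_unique[OF hole w] colours_distinct by blast
  then show False
  proof
    assume "\<not> repeats w c (c p)"
    then have "\<And>y. E w y \<Longrightarrow> c y = c p \<Longrightarrow> y = p" using wp unfolding repeats_def by blast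
    then show False using contra[of p q] pq by blast
  next
    assume "\<not> repeats w c (c q)"
    then have "\<And>y. E w y \<Longrightarrow> c y = c q \<Longrightarrow> y = q" using wq unfolding repeats_def by blast
    then show False using contra[of q p] pq by blast
  qed
qed

text \<open>
  If every neighbour of \<open>p\<close> in the colour of \<open>q\<close> could be recoloured, all of them could be at once, since
  they are pairwise nonadjacent; but then \<open>p\<close> would no longer see the colour of \<open>q\<close>.
\<close>

lemma ex_stuck:
  obtains a where "E p a" "c a = c q" "stuck c a"
proof -
  define A where "A = {a. E p a \<and> c a = c q}"
  have "\<exists>a\<in>A. stuck c a"
  proof (rule ccontr)
    assume no: "\<not> (\<exists>a\<in>A. stuck c a)"
    then have "\<forall>a\<in>A. \<exists>m<k. m \<noteq> c q \<and> (\<forall>y. E a y \<longrightarrow> c y \<noteq> m)"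
      unfolding stuck_def A_def by auto
    then obtain f where f: "\<And>a. a \<in> A \<Longrightarrow> f a < k \<and> f a \<noteq> c q \<and> (\<forall>y. E a y \<longrightarrow> c y \<noteq> f a)"
      by metis
    define c' where "c' x = (if x \<in> A then f x else c x)" for x
    have A: "E p a" "c a = c q" "\<not> E v a" "\<not> E a v" "a \<noteq> v" "a \<noteq> p" "f a \<noteq> c p" if "a \<in> A" for a
      using that not_adj_hole[of a] f[OF that] sym[of p a] irrefl[of p] Q unfolding A_def by auto
    have "c' x \<noteq> c' y" if e: "E x y" for x y
      using hole_neq[OF hole e] f[of x] f[of y] e sym[OF e] A(2)[of x] A(2)[of y] unfolding c'_def by auto
    moreover have "v \<notin> A" using A(5) by blast
    ultimately have h': "hole v c'"
      using hole f unfolding hole_def c'_def by auto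
    have p': "lone v c' p"
      using p A P unfolding lone_def c'_def by auto
    have "c' p = c p" unfolding c'_def using A(6) by auto
    then obtain y where "E p y" "c' y = c q"
      using lone_stuck[OF h' p'] Q(6) colours_distinct unfolding stuck_def by metis
    then show False using f[of y] unfolding c'_def A_def by (auto split: if_splits)
  qed
  then show ?thesis using that unfolding A_def by blast
qed

text \<open>
  As \<open>w\<close> and \<open>q\<close> are again nonadjacent lone neighbours of \<open>v\<close>, the lemma \<open>complete\<close> applies to them and joins
  \<open>a\<close> to a second vertex in the colour of \<open>w\<close>, one adjacent to \<open>q\<close>.
\<close>

lemma off_side_repeats:
  assumes a: "E p a" "c a = c q" and w: "lone v c w" "E w a" "\<not> E w q"
  shows "repeats a c (c w)"
proof -
  have "w \<noteq> q" using hole_neq[OF hole, of q a] w(2) a(2) by metis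
  then interpret wq: nonadjacent_pair V E k v c w q
    by unfold_locales (use hole q w in auto)
  obtain a' b' where b': "E q b'" "c b' = c w" by (rule wq.cross)
  have "E a b'" using wq.complete[OF w(2) a(2) b'] .
  moreover have "b' \<noteq> w" using b'(1) w(3) sym by blast
  ultimately show ?thesis using w(2) b' sym unfolding repeats_def by blast
qed

text \<open>
  The remaining way for \<open>w\<close> to attach to the five-cycle: along the side of \<open>p\<close>, but to the far vertex
  \<open>b\<close>.  The second five-cycle \<open>v, w, a', b', q\<close> must be attached to \<open>p\<close> through \<open>b'\<close>, and \<open>P\<^sub>5\<close>-freeness
  then makes \<open>b\<close> and \<open>b'\<close> adjacent, so \<open>b\<close> sees the colour of \<open>w\<close> at \<open>w\<close> and at \<open>b'\<close>.
\<close>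

lemma twisted_repeats:
  assumes a: "E p a" "c a = c q" and b: "E q b" "c b = c p" and clean: "\<not> repeats p c (c q)"
    and w: "lone v c w" "E w p" "\<not> E w q" "E w b" "\<not> E w a"
  shows "repeats b c (c w)"
proof -
  note W = lone_facts[OF hole w(1)]
  have ne: "\<And>x y. c x = c y \<Longrightarrow> \<not> E x y" using hole_neq[OF hole] by blast
  have "w \<noteq> q" using w nE' by auto
  then interpret wq: nonadjacent_pair V E k v c w q
    by unfold_locales (use hole q w in auto)
  obtain a' b' where ab': "E w a'" "c a' = c q" "E a' b'" "E q b'" "c b' = c w" by (rule wq.cross)
  have pa': "\<not> E p a'"
    using clean a ab' w(5) unfolding repeats_def by metis
  have "p \<noteq> w" using w(2) irrefl by blast
  then have pb': "E p b'"
    using wq.five_cycle_attach[OF ab'(1,2) ab'(4,5), of p] P pq nE pa' by blast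
  have ab: "E a b" using complete[OF a b] .
  have nv: "\<not> E v a" "\<not> E v b" "\<not> E v a'" "\<not> E v b'"
    using not_adj_hole[OF a] not_adj_hole'[OF b] wq.not_adj_hole[OF ab'(1,2)] wq.not_adj_hole'[OF ab'(4,5)]
    by blast+
  have 1: "\<not> E a' b"
    using no_P5[of a' b a p v] ab a b ab' P ne nv pa' sym by metis
  have 2: "\<not> E a b'"
    using no_P5[of a b' a' w v] a ab' W ne nv w(5) sym by metis
  have "E b b'"
    using no_P5[of a' b' p a b] ab a b ab' pa' pb' 1 2 ne sym by metis
  moreover have "b' \<noteq> w" using ab'(4) w(3) sym by blast
  ultimately show ?thesis using w(4) ab'(5) sym unfolding repeats_def by blast
qed

lemma lone_inj: "lone v c w \<Longrightarrow> lone v c w' \<Longrightarrow> c w = c w' \<Longrightarrow> w = w'"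
  unfolding lone_def by metis

lemma lone_colour: "lone v c w \<Longrightarrow> w \<noteq> p \<Longrightarrow> c w \<noteq> c p"
  using lone_inj p by blast

lemma lone_colour': "lone v c w \<Longrightarrow> w \<noteq> q \<Longrightarrow> c w \<noteq> c q"
  using lone_inj q by blast

lemma ex_lone_repeats: "lone v c x \<Longrightarrow> \<exists>d. {w. lone v c w \<and> repeats x c (c w)} \<subseteq> {d}"
  using lone_repeats_unique[OF hole] lone_inj by blast

text \<open>
  A stuck vertex that already repeats the colour of \<open>y\<close> has room for one more repeated colour.
\<close>

lemma ex_stuck_repeats:
  assumes "x \<in> V" "x \<noteq> v" "stuck c x" "repeats x c (c y)" "lone v c y"
  shows "\<exists>d. {w. lone v c w \<and> w \<noteq> y \<and> repeats x c (c w)} \<subseteq> {d}"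
proof -
  have "w = w'" if "lone v c w" "w \<noteq> y" "repeats x c (c w)" "lone v c w'" "w' \<noteq> y" "repeats x c (c w')" for w w'
  proof (rule ccontr)
    assume "w \<noteq> w'"
    then have "c w \<noteq> c w'" "c w \<noteq> c y" "c w' \<noteq> c y" using lone_inj that assms(5) by blast+
    then show False using stuck_no_three_reps[OF hole assms(1-3)] assms(4) that by metis
  qed
  then show ?thesis by blast
qed

lemma many_lone: "{w. lone v c w} \<subseteq> set ws \<Longrightarrow> length ws \<le> 6 \<Longrightarrow> False"
  using card_mono[of "set ws" "{w. lone v c w}"] card_length[of ws] card_lone[OF hole] k_ge by simp

lemma cross_facts:
  assumes a: "E p a" "c a = c q"
  shows "a \<in> V" "a \<noteq> v" "a \<noteq> q"
  using a EV' Q(6,7) nE by auto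

lemma cross_repeats:
  assumes a: "E p a" "c a = c q" and b: "E q b" "c b = c p"
  shows "repeats a c (c p)"
  using complete[OF a b] a b nE' sym unfolding repeats_def by metis

text \<open>
  When \<open>p\<close> and \<open>q\<close> see each other's colour once, \<open>a\<close> and \<open>b\<close> are unique and stuck.  Every lone neighbour other
  than \<open>p\<close> and \<open>q\<close> makes one of \<open>p\<close>, \<open>q\<close>, \<open>a\<close>, \<open>b\<close> repeat its colour, and each of the four does so for at
  most one.
\<close>

lemma clean_pair_False:
  assumes "\<not> repeats p c (c q)" "\<not> repeats q c (c p)"
  shows False
proof -
  interpret qp: nonadjacent_pair V E k v c q p by (rule swapped)
  obtain a where a: "E p a" "c a = c q" "stuck c a" by (rule ex_stuck)
  obtain b where b: "E q b" "c b = c p" "stuck c b" by (rule qp.ex_stuck)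
  have key: "repeats p c (c w) \<or> repeats q c (c w) \<or> repeats a c (c w) \<or> repeats b c (c w)"
    if w: "lone v c w" "w \<noteq> p" "w \<noteq> q" for w
  proof (cases "E w p \<and> E w q")
    case True
    then show ?thesis using common_lone w by blast
  next
    case False
    then have ab: "E w a \<or> E w b"
      using five_cycle_attach[OF a(1,2) b(1,2) _ w(2,3)] lone_facts[OF hole w(1)] by blast
    show ?thesis
      using ab False off_side_repeats[OF a(1,2) w(1)] qp.off_side_repeats[OF b(1,2) w(1)]
        twisted_repeats[OF a(1,2) b(1,2) assms(1) w(1)] qp.twisted_repeats[OF b(1,2) a(1,2) assms(2) w(1)]
      by blast
  qed
  obtain d1 where "{w. lone v c w \<and> repeats p c (c w)} \<subseteq> {d1}" using ex_lone_repeats[OF p] by blast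
  moreover obtain d2 where "{w. lone v c w \<and> repeats q c (c w)} \<subseteq> {d2}" using ex_lone_repeats[OF q] by blast
  moreover obtain d3 where "{w. lone v c w \<and> w \<noteq> p \<and> repeats a c (c w)} \<subseteq> {d3}"
    using ex_stuck_repeats[OF cross_facts(1,2)[OF a(1,2)] a(3) cross_repeats[OF a(1,2) b(1,2)] p] by blast
  moreover obtain d4 where "{w. lone v c w \<and> w \<noteq> q \<and> repeats b c (c w)} \<subseteq> {d4}"
    using ex_stuck_repeats[OF qp.cross_facts(1,2)[OF b(1,2)] b(3) qp.cross_repeats[OF b(1,2) a(1,2)] q] by blast
  ultimately have "{w. lone v c w} \<subseteq> set [p, q, d1, d2, d3, d4]"
    using key unfolding list.set by blast
  then show False by (rule many_lone) simp
qed

text \<open>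
  If \<open>q\<close> sees the colour of \<open>p\<close> at two vertices, then \<open>a\<close> sees it three times and can repeat no other
  colour.  What remains is charged to \<open>p\<close> or to the stuck vertex \<open>b\<close>, except for a lone neighbour \<open>w\<close>
  adjacent to \<open>a\<close> and \<open>q\<close> but not to \<open>p\<close> or \<open>b\<close>; such a \<open>w\<close> repeats the colour of \<open>q\<close>, so \<open>p\<close> and \<open>w\<close> are a clean
  pair unless \<open>p\<close> repeats the colour of \<open>w\<close>.
\<close>

lemma half_clean_pair_False:
  assumes clean: "\<not> repeats p c (c q)" and dirty: "repeats q c (c p)"
  shows False
proof -
  interpret qp: nonadjacent_pair V E k v c q p by (rule swapped)
  obtain a where a: "E p a" "c a = c q" "stuck c a" by (rule ex_stuck)
  obtain b where b: "E q b" "c b = c p" "stuck c b" by (rule qp.ex_stuck)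
  obtain b1 b2 where b12: "b1 \<noteq> b2" "E q b1" "E q b2" "c b1 = c p" "c b2 = c p"
    using dirty unfolding repeats_def by blast
  have a_full: "\<not> repeats a c m" if "m \<noteq> c p" for m
    using stuck_no_triple_and_rep[OF hole cross_facts(1,2)[OF a(1,2)] a(3), of m b1 b2 p] that
      complete[OF a(1,2)] b12 a(1) sym nE' by metis
  have key: "repeats p c (c w) \<or> repeats b c (c w)"
    if w: "lone v c w" "w \<noteq> p" "w \<noteq> q" for w
  proof -
    have att: "E w a \<or> E w b'" if "E q b'" "c b' = c p" "\<not> (E w p \<and> E w q)" for b'
      using five_cycle_attach[OF a(1,2) that(1,2) _ w(2,3) that(3)] lone_facts[OF hole w(1)] by blast
    consider "E w p" "E w q" | "\<not> E w q" | "\<not> E w p" "E w q" by blast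
    then show ?thesis
    proof cases
      case 1
      then show ?thesis
        using common_lone[OF w(1)] lone_repeats_unique[OF hole q dirty] lone_colour[OF w(1,2)] by metis
    next
      case 2
      have "\<not> E w a" using off_side_repeats[OF a(1,2) w(1) _ 2] a_full lone_colour[OF w(1,2)] by blast
      then have wb: "E w b1" "E w b2" "E w b" using att b12 b 2 by blast+
      have "\<not> E w p"
      proof
        assume "E w p"
        then show False
          using lone_no_triple[OF hole w(1) wb(1,2), of p] b12 nE' by metis
      qed
      then show ?thesis using qp.off_side_repeats[OF b(1,2) w(1) wb(3)] by blast
    next
      case 3
      show ?thesis
      proof (cases "E w b")
        case True
        then show ?thesis using qp.off_side_repeats[OF b(1,2) w(1)] 3 by blast
      next
        case False
        then have "E w a" using att b 3 by blast
        then have "repeats w c (c q)" using 3 a cross_facts[OF a(1,2)] unfolding repeats_def by blast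
        then have "\<not> repeats w c (c p)" using lone_repeats_unique[OF hole w(1)] colours_distinct by blast
        moreover have "nonadjacent_pair V E k v c p w"
          by unfold_locales (use hole p w 3 sym in auto)
        ultimately show ?thesis using nonadjacent_pair.clean_pair_False[of V E k v c p w] by blast
      qed
    qed
  qed
  obtain d1 where "{w. lone v c w \<and> repeats p c (c w)} \<subseteq> {d1}" using ex_lone_repeats[OF p] by blast
  moreover obtain d2 where "{w. lone v c w \<and> w \<noteq> q \<and> repeats b c (c w)} \<subseteq> {d2}"
    using ex_stuck_repeats[OF qp.cross_facts(1,2)[OF b(1,2)] b(3) qp.cross_repeats[OF b(1,2) a(1,2)] q] by blast
  ultimately have "{w. lone v c w} \<subseteq> set [p, q, d1, d2]" using key unfolding list.set by blast
  then show False by (rule many_lone) simp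
qed

text \<open>
  Here \<open>a\<close> and \<open>b\<close> both see one colour three times and repeat no other, so a lone neighbour that misses
  \<open>q\<close> is charged to nobody.
\<close>

lemma dirty_pair_common:
  assumes dp: "repeats p c (c q)" and dq: "repeats q c (c p)"
    and w: "lone v c w" "w \<noteq> p" "w \<noteq> q"
  shows "E w q"
proof (rule ccontr)
  assume wq: "\<not> E w q"
  interpret qp: nonadjacent_pair V E k v c q p by (rule swapped)
  obtain a where a: "E p a" "c a = c q" "stuck c a" by (rule ex_stuck)
  obtain b where b: "E q b" "c b = c p" "stuck c b" by (rule qp.ex_stuck)
  obtain a1 a2 where a12: "a1 \<noteq> a2" "E p a1" "E p a2" "c a1 = c q" "c a2 = c q"
    using dp unfolding repeats_def by blast
  obtain b1 b2 where b12: "b1 \<noteq> b2" "E q b1" "E q b2" "c b1 = c p" "c b2 = c p"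
    using dq unfolding repeats_def by blast
  have a_full: "\<not> repeats a c m" if "m \<noteq> c p" for m
    using stuck_no_triple_and_rep[OF hole cross_facts(1,2)[OF a(1,2)] a(3), of m b1 b2 p] that
      complete[OF a(1,2)] b12 a(1) sym nE' by metis
  have b_full: "\<not> repeats b c m" if "m \<noteq> c q" for m
    using stuck_no_triple_and_rep[OF hole qp.cross_facts(1,2)[OF b(1,2)] b(3), of m a1 a2 q] that
      qp.complete[OF b(1,2)] a12 b(1) sym nE by metis
  have "\<not> E w a" using off_side_repeats[OF a(1,2) w(1) _ wq] a_full lone_colour[OF w(1,2)] by blast
  then have wb: "E w b1" "E w b2" "E w b"
    using five_cycle_attach[OF a(1,2) _ _ _ w(2,3)] lone_facts[OF hole w(1)] b12 b wq by blast+
  show False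
  proof (cases "E w p")
    case True
    then show False using lone_no_triple[OF hole w(1) wb(1,2), of p] b12 nE' by metis
  next
    case False
    then show False
      using qp.off_side_repeats[OF b(1,2) w(1) wb(3)] b_full lone_colour'[OF w(1,3)] by blast
  qed
qed

lemma dirty_pair_False:
  assumes dp: "repeats p c (c q)" and dq: "repeats q c (c p)"
  shows False
proof -
  interpret qp: nonadjacent_pair V E k v c q p by (rule swapped)
  have "w = p \<or> w = q" if w: "lone v c w" for w
  proof (rule ccontr)
    assume n: "\<not> (w = p \<or> w = q)"
    then have "E w q" "E w p"
      using dirty_pair_common[OF dp dq w] qp.dirty_pair_common[OF dq dp w] by blast+
    then have "repeats p c (c w) \<or> repeats q c (c w)" using common_lone[OF w] by blast
    then show False
      using lone_repeats_unique[OF hole p dp] lone_repeats_unique[OF hole q dq] n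
        lone_colour[OF w] lone_colour'[OF w] by metis
  qed
  then have "{w. lone v c w} \<subseteq> set [p, q]" by auto
  then show False by (rule many_lone) simp
qed

lemma pair_impossible: False
  using clean_pair_False half_clean_pair_False dirty_pair_False
    nonadjacent_pair.half_clean_pair_False[OF swapped] by blast

end

lemma (in critical) lone_adjacent:
  assumes "hole v c" "lone v c p" "lone v c q" "p \<noteq> q"
  shows "E p q"
proof (rule ccontr)
  assume "\<not> E p q"
  then interpret nonadjacent_pair V E k v c p q
    by unfold_locales (use assms in auto)
  show False by (rule pair_impossible)
qed

context critical
begin

section \<open>Cliques through a hole\<close>

definition is_clique :: "'a set \<Rightarrow> bool" where
  "is_clique K \<longleftrightarrow> K \<subseteq> V \<and> (\<forall>x\<in>K. \<forall>y\<in>K. x \<noteq> y \<longrightarrow> E x y)"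

lemma is_clique_finite: "is_clique K \<Longrightarrow> finite K"
  unfolding is_clique_def using finV finite_subset by blast

lemma is_clique_card: "is_clique K \<Longrightarrow> card K \<le> k"
  unfolding is_clique_def by (intro clique_le) auto

lemma is_clique_insert: "is_clique K \<Longrightarrow> t \<in> V \<Longrightarrow> (\<And>s. s \<in> K \<Longrightarrow> s \<noteq> t \<Longrightarrow> E t s) \<Longrightarrow> is_clique (insert t K)"
  unfolding is_clique_def using sym by auto

lemma is_clique_subset: "is_clique K \<Longrightarrow> S \<subseteq> K \<Longrightarrow> is_clique S"
  unfolding is_clique_def by blast

lemma is_clique_adj: "is_clique K \<Longrightarrow> x \<in> K \<Longrightarrow> y \<in> K \<Longrightarrow> x \<noteq> y \<Longrightarrow> E x y"
  unfolding is_clique_def by blast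

lemma ex_nonneighbour:
  assumes "is_clique K" "card K = k" "t \<in> V" "t \<notin> K" shows "\<exists>s\<in>K. \<not> E t s"
proof (rule ccontr)
  assume "\<not> ?thesis"
  then have "is_clique (insert t K)" using is_clique_insert[OF assms(1,3)] by blast
  from is_clique_card[OF this] show False using assms is_clique_finite[OF assms(1)] by simp
qed

lemma degree_eq:
  assumes v: "v \<in> V" shows "card {y. E v y} = k + 1"
proof (rule ccontr)
  assume "card {y. E v y} \<noteq> k + 1"
  then have le: "card {y. E v y} \<le> k" using degree_le[OF v] by simp
  obtain c where h: "hole v c" using ex_hole[OF v] .
  have "lone v c x" if x: "E v x" for x
  proof (rule ccontr)
    assume "\<not> lone v c x"
    then obtain y where y: "E v y" "c y = c x" "x \<noteq> y" using x unfolding lone_def by auto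
    have "card {x} + k \<le> card {y. E v y}"
      by (rule surplus_hole[where W = "{y}", OF h]) (use x y in auto)
    then show False using le by simp
  qed
  then have "is_clique {y. E v y}"
    using lone_adjacent[OF h] EV' unfolding is_clique_def by blast
  then have "is_clique (insert v {y. E v y})" using is_clique_insert[OF _ v] by blast
  from is_clique_card[OF this] have "card {y. E v y} + 1 \<le> k" using irrefl by simp
  moreover have "k \<le> card {y. E v y}" using surplus_hole[OF h, of "{}" "{}"] by simp
  ultimately show False by simp
qed

lemma colourable_psubset:
  assumes "X \<subset> V" obtains c where "proper_on E k X c"
proof -
  obtain x where x: "x \<in> V" "x \<notin> X" using assms by blast
  obtain c where "proper_on E k (V - {x}) c" using colourable_minus[OF x(1)] by blast
  then have "proper_on E k X c" using assms x unfolding proper_on_def by blast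
  then show ?thesis using that by blast
qed

text \<open>
  The hypothesis counts the colours seen in \<open>X\<close>, not the neighbours; its uses rely on several
  neighbours sharing a colour.
\<close>

lemma greedy:
  assumes "finite S" "proper_on E k X c" "S \<inter> X = {}"
    "\<And>s. s \<in> S \<Longrightarrow> card (c ` {y \<in> X. E s y}) + card S \<le> k"
  shows "\<exists>c'. proper_on E k (S \<union> X) c' \<and> (\<forall>x\<in>X. c' x = c x)"
  using assms
proof (induction S arbitrary: X c)
  case empty
  then show ?case by auto
next
  case (insert s S)
  have fin: "finite (c ` {y \<in> X. E s y})" by simp
  have "card (c ` {y \<in> X. E s y}) < k" using insert.prems(3)[of s] insert.hyps by simp
  then have "\<not> {..<k} \<subseteq> c ` {y \<in> X. E s y}" using card_mono[OF fin, of "{..<k}"] by auto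
  then obtain m where m: "m < k" "m \<notin> c ` {y \<in> X. E s y}" by auto
  let ?c = "c(s := m)"
  have sX: "s \<notin> X" using insert.prems(2) by simp
  have 1: "proper_on E k (insert s X) ?c"
    by (rule proper_on_update[OF insert.prems(1) m(1) sym irrefl]) (use m in auto)
  have 2: "card (?c ` {y \<in> insert s X. E x y}) + card S \<le> k" if "x \<in> S" for x
  proof -
    have "?c ` {y \<in> insert s X. E x y} \<subseteq> insert m (c ` {y \<in> X. E x y})" using sX by auto
    then have "card (?c ` {y \<in> insert s X. E x y}) \<le> card (insert m (c ` {y \<in> X. E x y}))"
      by (rule card_mono[rotated]) simp
    also have "\<dots> \<le> card (c ` {y \<in> X. E x y}) + 1" by (simp add: card_insert_if)
    finally show ?thesis using insert.prems(3)[of x] that insert.hyps by simp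
  qed
  have 3: "S \<inter> insert s X = {}" using insert.prems(2) insert.hyps(2) by auto
  obtain c' where c': "proper_on E k (S \<union> insert s X) c'" "\<forall>x\<in>insert s X. c' x = ?c x"
    using insert.IH[OF 1 3 2] by blast
  have "\<forall>x\<in>X. c' x = c x" using c'(2) sX by auto
  then show ?case using c'(1) by (intro exI[of _ c']) simp
qed

lemma colour_independent:
  assumes c: "proper_on E k X c" and P: "\<And>x y. x \<in> P \<Longrightarrow> y \<in> P \<Longrightarrow> \<not> E x y" "P \<inter> X = {}"
    and few: "card (\<Union>p\<in>P. {y \<in> X. E p y}) < k" and fP: "finite P"
  obtains d where "d < k" "proper_on E k (P \<union> X) (\<lambda>x. if x \<in> P then d else c x)"
proof -
  let ?U = "\<Union>p\<in>P. {y \<in> X. E p y}"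
  have "finite ?U" using fP by auto
  then have "card (c ` ?U) < k" "finite (c ` ?U)" using few card_image_le[of ?U c] by auto
  then have "\<not> {..<k} \<subseteq> c ` ?U" using card_mono[of "c ` ?U" "{..<k}"] by auto
  then obtain d where d: "d < k" "d \<notin> c ` ?U" by auto
  have d': "c y \<noteq> d" if "p \<in> P" "y \<in> X" "E p y" for p y using d(2) that by blast
  have "proper_on E k (P \<union> X) (\<lambda>x. if x \<in> P then d else c x)"
    unfolding proper_on_def
  proof (intro conjI ballI impI)
    fix x assume "x \<in> P \<union> X" then show "(if x \<in> P then d else c x) < k"
      using c d(1) unfolding proper_on_def by auto
  next
    fix x y assume "x \<in> P \<union> X" "y \<in> P \<union> X" "E x y"
    then show "(if x \<in> P then d else c x) \<noteq> (if y \<in> P then d else c y)"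
      using c P(1)[of x y] d'[of x y] d'[of y x] sym[of x y] unfolding proper_on_def by auto
  qed
  then show ?thesis using that d(1) by blast
qed

lemma card_outside:
  assumes S: "is_clique S" and x: "x \<in> V" "x \<notin> S" and full: "\<And>s. s \<in> S \<Longrightarrow> E s x"
  shows "card {y. E x y \<and> y \<notin> S} + card S = k + 1"
proof -
  have "{y. E x y} = {y. E x y \<and> y \<notin> S} \<union> S" using full sym by auto
  moreover have "card ({y. E x y \<and> y \<notin> S} \<union> S) = card {y. E x y \<and> y \<notin> S} + card S"
    by (rule card_Un_disjoint) (use is_clique_finite[OF S] in auto)
  ultimately show ?thesis using degree_eq[OF x(1)] by simp
qed

lemma card_outside_member:
  assumes K: "is_clique K" and x: "x \<in> K"
  shows "card {y. E x y \<and> y \<notin> K} + card K = k + 2"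
proof -
  have "x \<in> V" using K x unfolding is_clique_def by blast
  moreover have "is_clique (K - {x})" using is_clique_subset[OF K] by blast
  ultimately have "card {y. E x y \<and> y \<notin> K - {x}} + card (K - {x}) = k + 1"
    using is_clique_adj[OF K _ x] by (intro card_outside) auto
  moreover have "{y. E x y \<and> y \<notin> K - {x}} = {y. E x y \<and> y \<notin> K}" using irrefl by auto
  ultimately show ?thesis using card_Suc_Diff1[OF is_clique_finite[OF K] x] by simp
qed

text \<open>
  Each vertex of \<open>P\<close> has only two neighbours outside \<open>S\<close>, so together they exclude at most six colours.
\<close>

lemma colour_complete_independent:
  assumes S: "is_clique S" "card S = k - 1" and P: "P \<subseteq> V" "finite P" "card P \<le> 3"
    and ind: "\<And>x y. x \<in> P \<Longrightarrow> y \<in> P \<Longrightarrow> \<not> E x y"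
    and full: "\<And>s x. s \<in> S \<Longrightarrow> x \<in> P \<Longrightarrow> E s x"
  obtains c d where "proper_on E k (V - S) c" "\<And>x. x \<in> P \<Longrightarrow> c x = d"
proof -
  have PS: "P \<inter> S = {}" using full irrefl by blast
  have "S \<noteq> {}" using S k_ge by auto
  then have "V - S - P \<subset> V" using S(1) unfolding is_clique_def by blast
  then obtain c where c: "proper_on E k (V - S - P) c" by (rule colourable_psubset)
  have "card (\<Union>p\<in>P. {y \<in> V - S - P. E p y}) \<le> (\<Sum>p\<in>P. card {y \<in> V - S - P. E p y})"
    using P(2) by (rule card_UN_le)
  also have "\<dots> \<le> (\<Sum>p\<in>P. 2)"
  proof (rule sum_mono)
    fix p assume p: "p \<in> P"
    have "card {y. E p y \<and> y \<notin> S} + card S = k + 1"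
      by (rule card_outside[OF S(1)]) (use p P PS full in auto)
    then have "card {y. E p y \<and> y \<notin> S} = 2" using S(2) k_ge by simp
    moreover have "card {y \<in> V - S - P. E p y} \<le> card {y. E p y \<and> y \<notin> S}"
      by (rule card_mono) (auto intro: finite_subset[OF _ finite_nbrs])
    ultimately show "card {y \<in> V - S - P. E p y} \<le> 2" by simp
  qed
  also have "\<dots> < k" using P(3) k_ge by simp
  finally have few: "card (\<Union>p\<in>P. {y \<in> V - S - P. E p y}) < k" .
  obtain d where "proper_on E k (P \<union> (V - S - P)) (\<lambda>x. if x \<in> P then d else c x)"
    by (rule colour_independent[OF c ind _ few P(2)]) auto
  moreover have "P \<union> (V - S - P) = V - S" using P PS by blast
  ultimately show ?thesis using that[of "\<lambda>x. if x \<in> P then d else c x" d] by simp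
qed

text \<open>
  Suppose \<open>p\<close> and \<open>q\<close> are not adjacent.  They can be given the same colour, and the rest of the graph can
  be coloured up to one vertex \<open>s\<close> of \<open>S\<close>.  At this hole \<open>p\<close> and \<open>q\<close> are the repeated colour, so the third
  outer neighbour \<open>e s\<close> is lone and thus adjacent to all of \<open>S\<close>.  Hence \<open>e s\<close> is the same vertex \<open>t\<close> for
  all \<open>s\<close>, and by the bound on cliques \<open>p\<close>, \<open>q\<close>, \<open>t\<close> are independent.  Giving these three one colour
  leaves \<open>k - 1\<close> colours for the \<open>k - 1\<close> vertices of \<open>S\<close>.
\<close>

lemma clique_joined_adjacent:
  assumes S: "is_clique S" "card S = k - 1" and pq: "p \<in> V" "q \<in> V" "p \<noteq> q"
    and full: "\<And>s. s \<in> S \<Longrightarrow> E s p" "\<And>s. s \<in> S \<Longrightarrow> E s q"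
  shows "E p q"
proof (rule ccontr)
  assume nE: "\<not> E p q"
  have nE': "\<not> E q p" using nE sym by blast
  have fS: "finite S" using is_clique_finite[OF S(1)] .
  have pqS: "p \<notin> S" "q \<notin> S" using full irrefl by blast+
  have third: "\<exists>t. {y. E s y \<and> y \<notin> S} = {p, q, t} \<and> t \<noteq> p \<and> t \<noteq> q" if s: "s \<in> S" for s
  proof -
    have "card {y. E s y \<and> y \<notin> S} = 3"
      using card_outside_member[OF S(1) s] S(2) k_ge by simp
    moreover have "{p, q} \<subseteq> {y. E s y \<and> y \<notin> S}" using full s pqS by blast
    ultimately have "card ({y. E s y \<and> y \<notin> S} - {p, q}) = 1"
      using pq(3) by (simp add: card_Diff_subset)
    then obtain t where "{y. E s y \<and> y \<notin> S} - {p, q} = {t}" using card_1_singletonE by blast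
    then show ?thesis using \<open>{p, q} \<subseteq> _\<close> by blast
  qed
  then obtain e where e: "\<And>s. s \<in> S \<Longrightarrow> {y. E s y \<and> y \<notin> S} = {p, q, e s} \<and> e s \<noteq> p \<and> e s \<noteq> q"
    by metis
  obtain c d where c: "proper_on E k (V - S) c" "\<And>x. x \<in> {p, q} \<Longrightarrow> c x = d"
    by (rule colour_complete_independent[OF S, of "{p, q}"])
      (use pq nE nE' irrefl full in auto)
  have shared: "E (e s) s'" if s: "s \<in> S" "s' \<in> S" "s' \<noteq> s" for s s'
  proof -
    have sV: "s \<in> V" using s S(1) unfolding is_clique_def by blast
    have "card (c ` {y \<in> V - S. E x y}) + card (S - {s}) \<le> k" if x: "x \<in> S - {s}" for x
    proof -
      have "{y \<in> V - S. E x y} \<subseteq> {p, q, e x}" using e[of x] x by blast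
      then have "c ` {y \<in> V - S. E x y} \<subseteq> {d, c (e x)}" using c(2) by blast
      then have "card (c ` {y \<in> V - S. E x y}) \<le> card {d, c (e x)}" by (rule card_mono[rotated]) simp
      also have "\<dots> \<le> 2" by (simp add: card_insert_if)
      finally show ?thesis using S(2) s(1) k_ge fS by simp
    qed
    then obtain c' where c': "proper_on E k (S - {s} \<union> (V - S)) c'" "\<forall>x\<in>V - S. c' x = c x"
      using greedy[OF _ c(1), of "S - {s}"] fS by blast
    have "S - {s} \<union> (V - S) = V - {s}" using S(1) s(1) unfolding is_clique_def by blast
    with c'(1) have h: "hole s (c'(s := k))" using hole_of_proper sV by simp
    have col: "(c'(s := k)) p = (c'(s := k)) q"
      using c' c(2) pq pqS s(1) by auto
    have lone: "lone s (c'(s := k)) y" if "E s y" "y \<noteq> p" "y \<noteq> q" for y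
      using others_lone[OF h full(1)[OF s(1)] full(2)[OF s(1)] col pq(3) that] .
    have es: "E s (e s)" "e s \<notin> S" "e s \<noteq> p" "e s \<noteq> q" using e[OF s(1)] by blast+
    have "E s s'" using is_clique_adj[OF S(1)] s by blast
    moreover have "s' \<noteq> p" "s' \<noteq> q" "s' \<noteq> e s" using pqS es s by blast+
    ultimately show ?thesis using lone_adjacent[OF h lone lone] es by metis
  qed
  have "S \<noteq> {}" using S(2) k_ge by auto
  then obtain s0 where s0: "s0 \<in> S" by blast
  define t where "t = e s0"
  have t: "t \<notin> S" "t \<noteq> p" "t \<noteq> q" "E s0 t" using e[OF s0] unfolding t_def by blast+
  have tV: "t \<in> V" using t EV' by blast
  have ts: "E s t" if "s \<in> S" for s
    using shared[OF s0 that] t(4) sym unfolding t_def by (cases "s = s0") auto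
  have no: "\<not> E x t" if x: "x \<in> V" "x \<notin> S" "\<And>s. s \<in> S \<Longrightarrow> E s x" "x \<noteq> t" for x
  proof
    assume xt: "E x t"
    have "is_clique (insert x S)" using is_clique_insert[OF S(1) x(1)] x(3) sym by blast
    moreover have "card (insert x S) = k" using x(2) fS S(2) k_ge by simp
    ultimately obtain s where "s \<in> insert x S" "\<not> E t s"
      using ex_nonneighbour[of "insert x S" t] tV t x(4) by blast
    then show False using xt ts sym by blast
  qed
  have nt: "\<not> E p t" "\<not> E q t" using no pq pqS full t by blast+
  have nt': "\<not> E t p" "\<not> E t q" using nt sym by blast+
  obtain c1 d1 where c1: "proper_on E k (V - S) c1" "\<And>x. x \<in> {p, q, t} \<Longrightarrow> c1 x = d1"
    by (rule colour_complete_independent[OF S, of "{p, q, t}"])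
      (use pq nE nE' irrefl full nt nt' tV ts t in \<open>auto simp: card_insert_if\<close>)
  have "card (c1 ` {y \<in> V - S. E s y}) + card S \<le> k" if s: "s \<in> S" for s
  proof -
    have "e s = t" using e[OF s] ts[OF s] t by blast
    then have "{y \<in> V - S. E s y} \<subseteq> {p, q, t}" using e[OF s] by blast
    then have "c1 ` {y \<in> V - S. E s y} \<subseteq> {d1}" using c1(2) by blast
    then have "card (c1 ` {y \<in> V - S. E s y}) \<le> 1" using card_mono[of "{d1}"] by fastforce
    then show ?thesis using S(2) k_ge by simp
  qed
  then obtain c2 where "proper_on E k (S \<union> (V - S)) c2"
    using greedy[OF fS c1(1)] by blast
  moreover have "S \<union> (V - S) = V" using S(1) unfolding is_clique_def by blast
  ultimately show False using not_colourable by simp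
qed

lemma ex_second_nonneighbour:
  assumes K: "is_clique K" "card K = k" and t: "t \<in> V" "t \<notin> K" and u: "u \<in> K"
  shows "\<exists>s\<in>K. s \<noteq> u \<and> \<not> E t s"
proof (rule ccontr)
  assume no: "\<not> ?thesis"
  have uV: "u \<in> V" using K u unfolding is_clique_def by blast
  have "E u t"
  proof (rule clique_joined_adjacent[of "K - {u}"])
    show "is_clique (K - {u})" using is_clique_subset[OF K(1)] by blast
    show "E s u" if "s \<in> K - {u}" for s using is_clique_adj[OF K(1), of s u] that u by blast
    show "E s t" if "s \<in> K - {u}" for s using no that sym by blast
  qed (use K(2) t u uV in auto)
  then have "E t u" by (rule sym)
  moreover obtain s where "s \<in> K" "\<not> E t s" using ex_nonneighbour[OF K t] by blast
  ultimately show False using no by metis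
qed

text \<open>
  The hole and its lone neighbours form \<open>K\<close>, and \<open>z\<close> is the repeated colour.  An outer neighbour \<open>w\<close> of
  \<open>s\<close> in another colour duplicates some \<open>u\<close> in \<open>K\<close> when the hole is moved to \<open>s\<close>.  The vertex \<open>t\<close> in colour
  \<open>z\<close> that \<open>s\<close> sees is then lone, so it is adjacent to all of \<open>K\<close> except \<open>u\<close>, which
  \<open>ex_second_nonneighbour\<close> forbids.
\<close>

lemma hole_in_clique:
  assumes h: "hole v c"
  obtains K z where "is_clique K" "card K = k" "v \<in> K" "z < k"
    "\<And>s y. s \<in> K \<Longrightarrow> E s y \<Longrightarrow> y \<notin> K \<Longrightarrow> c y = z"
proof -
  have v: "v \<in> V" using h unfolding hole_def by blast
  let ?N = "{y. E v y}"
  have "c ` ?N \<subseteq> {..<k}" using hole_less[OF h] irrefl by auto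
  then have "card (c ` ?N) \<le> k" using card_mono[of "{..<k}" "c ` ?N"] by simp
  then have "\<not> inj_on c ?N" using pigeonhole[of c ?N] degree_eq[OF v] by simp
  then obtain x y where xy: "E v x" "E v y" "c x = c y" "x \<noteq> y" unfolding inj_on_def by blast
  note lone = others_lone[OF h xy]
  define z where "z = c x"
  define A where "A = ?N - {x, y}"
  define K where "K = insert v A"
  have zk: "z < k" using hole_less[OF h xy(1)] xy(1) irrefl unfolding z_def by blast
  have A: "lone v c s" "c s \<noteq> z" "E v s" "s \<noteq> v" "c s < k" if "s \<in> A" for s
  proof -
    have s: "E v s" "s \<noteq> x" "s \<noteq> y" using that unfolding A_def by auto
    show l: "lone v c s" using lone s by blast
    show "c s \<noteq> z" using l xy(1) s(2) unfolding lone_def z_def by metis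
    show "E v s" "s \<noteq> v" "c s < k" using s(1) lone_facts[OF h l] by blast+
  qed
  have vA: "v \<notin> A" using A by blast
  have K: "is_clique K"
    unfolding K_def
  proof (rule is_clique_insert[OF _ v])
    have "A \<subseteq> V" using EV'[OF A(3)] by blast
    then show "is_clique A" using lone_adjacent[OF h A(1) A(1)] unfolding is_clique_def by blast
  qed (use A(3) in blast)
  have cA: "card A = k - 1" using degree_eq[OF v] xy unfolding A_def by simp
  have cK: "card K = k" using cA vA is_clique_finite[OF K] k_ge unfolding K_def by simp
  have "c w = z" if s: "s \<in> K" and w: "E s w" "w \<notin> K" for s w
  proof (cases "s = v")
    case True
    then show ?thesis using w xy unfolding K_def A_def z_def by auto
  next
    case False
    then have sA: "s \<in> A" using s unfolding K_def by blast
    note s' = A[OF sA]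
    let ?c = "c(v := c s, s := k)"
    have h': "hole s ?c" by (rule hole_shift[OF h s'(1)])
    show ?thesis
    proof (rule ccontr)
      assume wz: "c w \<noteq> z"
      obtain t where t: "E s t" "?c t = z" using hole_sees[OF h' zk] by blast
      have ts: "t \<noteq> s" "t \<noteq> v" using t irrefl[of s] s'(2,4) by (auto split: if_splits)
      then have ct: "c t = z" using t by simp
      then have tK: "t \<notin> K" using A ts unfolding K_def by blast
      have wvs: "w \<noteq> v" "w \<noteq> s" using w s unfolding K_def by auto
      have img: "?c ` (K - {s}) = {..<k} - {z}"
      proof (rule card_subset_eq)
        show "?c ` (K - {s}) \<subseteq> {..<k} - {z}" using A s' unfolding K_def by auto
        have inj: "inj_on ?c (K - {s})"
        proof (rule inj_onI)
          fix a b assume ab: "a \<in> K - {s}" "b \<in> K - {s}" "?c a = ?c b"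
          show "a = b"
            using ab s' vA A(1)[of a] A(1)[of b] A(1)[OF sA] unfolding K_def lone_def
            by (auto split: if_splits)
        qed
        show "card (?c ` (K - {s})) = card ({..<k} - {z})"
          using card_image[OF inj] cK s zk by simp
      qed simp
      have "c w < k" using hole_less[OF h w(1)] wvs by blast
      then have "c w \<in> ?c ` (K - {s})" using img wz by simp
      then obtain u where "u \<in> K - {s}" "c w = ?c u" by (rule imageE) blast
      then have u: "u \<in> K" "u \<noteq> s" "?c u = ?c w" using wvs by auto
      have su: "E s u" using is_clique_adj[OF K s u(1)] u(2) by simp
      have uw: "u \<noteq> w" using u w by blast
      have tl: "lone s ?c t"
        by (rule others_lone[OF h' su w(1) u(3) uw t(1)]) (use tK u ct wz in auto)
      have "E t r" if r: "r \<in> K" "r \<noteq> u" for r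
      proof (cases "r = s")
        case True then show ?thesis using t sym by blast
      next
        case False
        have "lone s ?c r"
          by (rule others_lone[OF h' su w(1) u(3) uw]) (use is_clique_adj[OF K s r(1)] False r w in auto)
        then show ?thesis using lone_adjacent[OF h' tl] tK r by blast
      qed
      then show False using ex_second_nonneighbour[OF K cK _ tK u(1)] EV'[OF t(1)] by blast
    qed
  qed
  then show ?thesis using that[OF K cK _ zk] unfolding K_def by blast
qed

text \<open>
  Unlike in \<open>hole_in_clique\<close>, the clique is given before the colouring.  It agrees with the clique found
  there, since two \<open>k\<close>-cliques cannot differ in just one vertex.
\<close>

lemma clique_boundary_monochromatic:
  assumes K: "is_clique K" "card K = k" "v \<in> K" and h: "hole v c"
  obtains z where "z < k" "\<And>s y. s \<in> K \<Longrightarrow> E s y \<Longrightarrow> y \<notin> K \<Longrightarrow> c y = z"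
proof -
  obtain K' z where K': "is_clique K'" "card K' = k" "v \<in> K'" "z < k"
    "\<And>s y. s \<in> K' \<Longrightarrow> E s y \<Longrightarrow> y \<notin> K' \<Longrightarrow> c y = z" using hole_in_clique[OF h] by blast
  have "K = K'"
  proof (rule ccontr)
    assume ne: "K \<noteq> K'"
    then have "\<not> K' \<subseteq> K"
      using card_subset_eq[of K K'] K K' is_clique_finite by metis
    moreover have "\<not> K \<subseteq> K'" using ne card_subset_eq[of K' K] K K' is_clique_finite by metis
    ultimately obtain t u where tu: "t \<in> K'" "t \<notin> K" "u \<in> K" "u \<notin> K'" by blast
    have col: "c r = z" if "r \<in> K" "r \<notin> K'" for r
      using K'(5)[OF K'(3) is_clique_adj[OF K(1,3) that(1)] that(2)] that K'(3) by blast
    have sub: "r \<in> K'" if "r \<in> K" "r \<noteq> u" for r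
      using col[OF that(1)] col[OF tu(3,4)] hole_neq[OF h is_clique_adj[OF K(1) that(1) tu(3) that(2)]] by auto
    have "t \<in> V" using tu K' unfolding is_clique_def by blast
    then obtain s where "s \<in> K" "s \<noteq> u" "\<not> E t s"
      using ex_second_nonneighbour[OF K(1,2) _ tu(2,3)] by blast
    then show False using is_clique_adj[OF K'(1) tu(1) sub] tu by blast
  qed
  then show ?thesis using that K' by blast
qed

section \<open>The boundary of a clique\<close>

definition boundary :: "'a set \<Rightarrow> 'a set" where
  "boundary K = {t. t \<notin> K \<and> (\<exists>s\<in>K. E s t)}"

text \<open>
  A vertex \<open>t\<close> recoloured with \<open>b\<close> gives a boundary with two colours.  The colouring still extends to all of
  \<open>K\<close> but one vertex: \<open>K\<close> may use every colour except \<open>z\<close>, and \<open>t\<close> has two nonneighbours in \<open>K\<close>, one to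
  take the colour \<open>b\<close> and one to be the hole.
\<close>

lemma boundary_colour_forced:
  assumes K: "is_clique K" "card K = k"
    and c1: "proper_on E k (V - K) c1" "\<And>t. t \<in> boundary K \<Longrightarrow> c1 t = z"
    and z: "z < k" and t: "t \<in> boundary K" and b: "b < k" "b \<noteq> z"
  shows "\<exists>y. E t y \<and> y \<notin> K \<and> c1 y = b"
proof (rule ccontr)
  assume free: "\<not> ?thesis"
  have fK: "finite K" and KV: "K \<subseteq> V"
    using is_clique_finite[OF K(1)] K(1) unfolding is_clique_def by blast+
  have tK: "t \<in> V" "t \<notin> K" using t EV' unfolding boundary_def by blast+
  obtain s0 where s0: "s0 \<in> K" "\<not> E t s0" using ex_nonneighbour[OF K(1,2) tK] by blast
  obtain v0 where v0: "v0 \<in> K" "v0 \<noteq> s0" "\<not> E t v0" using ex_second_nonneighbour[OF K(1,2) tK s0(1)] by blast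
  have "card (K - {v0, s0}) = card ({..<k} - {z, b})"
    using K(2) v0 s0 fK z b by simp
  then obtain f where "bij_betw f (K - {v0, s0}) ({..<k} - {z, b})"
    using finite_same_card_bij[of "K - {v0, s0}" "{..<k} - {z, b}"] fK by auto
  then have f: "inj_on f (K - {v0, s0})" "\<And>x. x \<in> K - {v0, s0} \<Longrightarrow> f x < k \<and> f x \<noteq> z \<and> f x \<noteq> b"
    unfolding bij_betw_def by auto
  define g where "g = f(s0 := b)"
  define c2 where "c2 x = (if x \<in> K then g x else if x = t then b else c1 x)" for x
  have g: "g x < k" "g x \<noteq> z" "x \<noteq> s0 \<Longrightarrow> g x \<noteq> b" if "x \<in> K - {v0}" for x
    using f(2)[of x] that b unfolding g_def by auto
  have ginj: "g x \<noteq> g y" if "x \<in> K - {v0}" "y \<in> K - {v0}" "x \<noteq> y" for x y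
    using that f(2)[of x] f(2)[of y] inj_onD[OF f(1), of x y] unfolding g_def by auto
  have mixed: "c2 x \<noteq> c2 y" if "x \<in> K - {v0}" "y \<notin> K" "E x y" for x y
  proof -
    have "y \<in> boundary K" using that unfolding boundary_def by blast
    moreover have "x \<noteq> s0" if "y = t" using that \<open>E x y\<close> s0 sym by blast
    ultimately show ?thesis using that g[of x] c1(2)[of y] unfolding c2_def by auto
  qed
  have out: "c2 x \<noteq> c2 y" if "x \<in> V" "y \<in> V" "x \<notin> K" "y \<notin> K" "E x y" for x y
    using that free c1(1) sym[of x y] irrefl[of t] unfolding c2_def proper_on_def by auto
  have "proper_on E k (V - {v0}) c2"
    unfolding proper_on_def
  proof (intro conjI ballI impI)
    fix x assume "x \<in> V - {v0}"
    then show "c2 x < k" using g[of x] c1(1) b unfolding c2_def proper_on_def by auto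
  next
    fix x y assume xy: "x \<in> V - {v0}" "y \<in> V - {v0}" "E x y"
    consider "x \<in> K" "y \<in> K" | "x \<in> K" "y \<notin> K" | "x \<notin> K" "y \<in> K" | "x \<notin> K" "y \<notin> K" by blast
    then show "c2 x \<noteq> c2 y"
    proof cases
      case 1
      then show ?thesis using ginj[of x y] xy irrefl[of x] unfolding c2_def by auto
    next
      case 2 then show ?thesis using mixed[of x y] xy by blast
    next
      case 3 then show ?thesis using mixed[of y x] xy sym by force
    next
      case 4 then show ?thesis using out[of x y] xy by blast
    qed
  qed
  then have "hole v0 (c2(v0 := k))" using hole_of_proper v0(1) KV by blast
  then obtain z' where z': "\<And>s y. s \<in> K \<Longrightarrow> E s y \<Longrightarrow> y \<notin> K \<Longrightarrow> (c2(v0 := k)) y = z'"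
    using clique_boundary_monochromatic[OF K(1,2) v0(1)] by blast
  have "card {y. E v0 y \<and> y \<notin> K} \<noteq> 0"
    using card_outside_member[OF K(1) v0(1)] K(2) by linarith
  then have "{y. E v0 y \<and> y \<notin> K} \<noteq> {}" by (metis card.empty)
  then obtain t' where t': "E v0 t'" "t' \<notin> K" by blast
  have "t' \<noteq> t" using t' v0(3) sym by blast
  have "t' \<in> boundary K" using t' v0(1) unfolding boundary_def by blast
  have "z' = z" using z'[OF v0(1) t'] t' v0 \<open>t' \<noteq> t\<close> c1(2)[OF \<open>t' \<in> boundary K\<close>] unfolding c2_def by (auto split: if_splits)
  moreover obtain s where "s \<in> K" "E s t" using t unfolding boundary_def by blast
  then have "z' = b" using z'[of s t] tK v0(1) unfolding c2_def by (auto split: if_splits)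
  ultimately show False using b by simp
qed

text \<open>
  For \<open>t\<close> in \<open>T\<close> and an outer neighbour \<open>w\<close> of \<open>t\<close>, a vertex \<open>t'\<close> in \<open>T\<close> with no neighbour in \<open>K\<close> in common
  with \<open>t\<close> is adjacent to \<open>w\<close>, as otherwise \<open>w t s s' t'\<close> is an induced \<open>P\<^sub>5\<close>.  At most two
  vertices of \<open>T\<close> other than \<open>t\<close> share a neighbour in \<open>K\<close> with \<open>t\<close>, so \<open>w\<close> has at least \<open>k - 2\<close>
  neighbours in the monochromatic \<open>T\<close> and at most three elsewhere.  If \<open>w\<close> is chosen as the only outer neighbour of \<open>t\<close> in its colour, recolouring \<open>w\<close>
  makes that colour available to \<open>t\<close>.
\<close>

lemma critical_impossible: False
proof -
  have "V \<noteq> {}" using not_colourable unfolding proper_on_def by auto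
  then obtain v where v: "v \<in> V" by blast
  obtain c where h: "hole v c" using ex_hole[OF v] .
  obtain K z where K: "is_clique K" "card K = k" "v \<in> K" and z: "z < k"
    "\<And>s y. s \<in> K \<Longrightarrow> E s y \<Longrightarrow> y \<notin> K \<Longrightarrow> c y = z" using hole_in_clique[OF h] by blast
  have fK: "finite K" using is_clique_finite[OF K(1)] .
  define T where "T = boundary K"
  have TV: "T \<subseteq> V" unfolding T_def boundary_def using EV' by blast
  have fT: "finite T" using TV finV finite_subset by blast
  have Tz: "c t = z" if "t \<in> T" for t using that z(2) unfolding T_def boundary_def by blast
  have out2: "card {y. E s y \<and> y \<notin> K} = 2" if "s \<in> K" for s
    using card_outside_member[OF K(1) that] K(2) by simp
  have c0: "proper_on E k (V - K) c" using h K(3) unfolding hole_def proper_on_def by auto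
  have few: "card {s \<in> K. E s t} \<le> 2" if t: "t \<in> T" for t
  proof -
    have "{..<k} - {z} \<subseteq> c ` {y. E t y \<and> y \<notin> K}"
      using boundary_colour_forced[OF K(1,2), folded T_def, OF c0 Tz z(1) t] by auto
    then have "card ({..<k} - {z}) \<le> card (c ` {y. E t y \<and> y \<notin> K})"
      by (rule card_mono[rotated]) (auto intro: finite_subset[OF _ finite_nbrs])
    also have "\<dots> \<le> card {y. E t y \<and> y \<notin> K}"
      by (rule card_image_le) (auto intro: finite_subset[OF _ finite_nbrs])
    finally have "k - 1 \<le> card {y. E t y \<and> y \<notin> K}" using z(1) by simp
    moreover have "card {y. E t y} = card {y. E t y \<and> y \<notin> K} + card {s \<in> K. E s t}"
    proof -
      have "{y. E t y} = {y. E t y \<and> y \<notin> K} \<union> {s \<in> K. E s t}" using sym by auto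
      also have "card \<dots> = card {y. E t y \<and> y \<notin> K} + card {s \<in> K. E s t}"
        by (rule card_Un_disjoint) (auto simp: fK intro: finite_subset[OF _ finite_nbrs])
      finally show ?thesis .
    qed
    moreover have "card {y. E t y} \<le> k + 1" using degree_le TV t by blast
    ultimately show ?thesis by linarith
  qed
  have TK: "{t \<in> T. E s t} = {y. E s y \<and> y \<notin> K}" if "s \<in> K" for s
    using that unfolding T_def boundary_def by auto
  have "k \<le> card T"
  proof -
    have "(\<Sum>s\<in>K. card {t \<in> T. E s t}) = (\<Sum>t\<in>T. card {s \<in> K. E s t})"
      by (rule sum_multicount_gen) (use fK fT in auto)
    also have "\<dots> \<le> (\<Sum>t\<in>T. 2)" using few by (rule sum_mono)
    also have "(\<Sum>s\<in>K. card {t \<in> T. E s t}) = (\<Sum>s\<in>K. 2)"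
      using TK out2 by (intro sum.cong) auto
    finally show ?thesis using K(2) by simp
  qed
  then have "T \<noteq> {}" using k_ge by auto
  then obtain t where t: "t \<in> T" by blast
  have tK: "t \<in> V" "t \<notin> K" using t TV unfolding T_def boundary_def by blast+
  obtain s where s: "s \<in> K" "E s t" using t unfolding T_def boundary_def by blast
  let ?O = "{y. E t y \<and> y \<notin> K}"
  have fO: "finite ?O" by (rule finite_subset[OF _ finite_nbrs]) auto
  have cO: "card ?O \<le> k"
  proof -
    have "?O \<subseteq> {y. E t y} - {s}" using s by blast
    then have "card ?O \<le> card ({y. E t y} - {s})" by (rule card_mono[rotated]) simp
    also have "\<dots> = card {y. E t y} - 1" using s sym by simp
    finally show ?thesis using degree_le[OF tK(1)] by simp
  qed
  obtain b w where b: "b < k" "b \<noteq> z" and w: "E t w" "w \<notin> K" "c w = b"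
    and wu: "\<And>y. E t y \<Longrightarrow> y \<notin> K \<Longrightarrow> c y = b \<Longrightarrow> y = w"
  proof (rule ccontr)
    assume no: "\<not> thesis"
    note obt = that
    have two: "\<exists>y y'. y \<in> ?O \<and> y' \<in> ?O \<and> y \<noteq> y' \<and> c y = b \<and> c y' = b" if b: "b < k" "b \<noteq> z" for b
    proof -
      obtain y where y: "E t y" "y \<notin> K" "c y = b" using boundary_colour_forced[OF K(1,2), folded T_def, OF c0 Tz z(1) t b] by blast
      show ?thesis using no obt[OF b y] y by blast
    qed
    have "card ({..<k} - {z}) \<ge> 2" using z(1) k_ge by simp
    then obtain b1 b2 where bb: "b1 \<noteq> b2" "b1 < k" "b1 \<noteq> z" "b2 < k" "b2 \<noteq> z"
      by (auto simp: card_le_Suc_iff numeral_2_eq_2)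
    obtain x x' where x: "x \<in> ?O" "x' \<in> ?O" "x \<noteq> x'" "c x = b1" "c x' = b1" using two bb by blast
    obtain y y' where y: "y \<in> ?O" "y' \<in> ?O" "y \<noteq> y'" "c y = b2" "c y' = b2" using two bb by blast
    have "card {x, y} + card ({..<k} - {z}) \<le> card ?O"
    proof (rule card_surplus[where f = c, OF fO])
      show "{..<k} - {z} \<subseteq> c ` ?O" using boundary_colour_forced[OF K(1,2), folded T_def, OF c0 Tz z(1) t] by auto
      show "\<exists>r\<in>?O - {x, y}. c r = c a" if "a \<in> {x, y}" for a
        using that x y bb(1) by (cases "a = x") (metis Diff_iff insert_iff empty_iff)+
    qed (use x y in auto)
    moreover have "x \<noteq> y" using x y bb by auto
    ultimately show False using cO z(1) k_ge by simp
  qed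
  have wT: "w \<notin> T" using Tz w b by auto
  have wnK: "\<not> E r w" if "r \<in> K" for r using that wT w unfolding T_def boundary_def by blast
  have wV: "w \<in> V" using w EV' by blast
  define M where "M = {t' \<in> T. t' \<noteq> t \<and> (\<exists>s\<in>K. E s t \<and> E s t')}"
  have wM: "E w t'" if t': "t' \<in> T" "t' \<noteq> t" "t' \<notin> M" for t'
  proof (rule ccontr)
    assume nE: "\<not> E w t'"
    obtain s' where s': "s' \<in> K" "E s' t'" using t' unfolding T_def boundary_def by blast
    have dis: "\<not> E s t'" "\<not> E s' t" using t' s s' unfolding M_def by blast+
    then have "E s s'" using is_clique_adj[OF K(1) s(1) s'(1)] s s' by blast
    moreover have "\<not> E t t'" using hole_neq[OF h] Tz t t' by metis
    ultimately show False
      using no_P5[of w t s s' t'] w s s' dis nE wnK sym by metis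
  qed
  have cM: "card M \<le> 2"
  proof -
    have "M \<subseteq> (\<Union>s\<in>{s \<in> K. E s t}. {y. E s y \<and> y \<notin> K} - {t})"
      unfolding M_def T_def boundary_def by blast
    then have "card M \<le> card (\<Union>s\<in>{s \<in> K. E s t}. {y. E s y \<and> y \<notin> K} - {t})"
      by (rule card_mono[rotated]) (auto simp: fK intro: finite_subset[OF _ finite_nbrs])
    also have "\<dots> \<le> (\<Sum>s\<in>{s \<in> K. E s t}. card ({y. E s y \<and> y \<notin> K} - {t}))"
      by (rule card_UN_le) (simp add: fK)
    also have "\<dots> \<le> (\<Sum>s\<in>{s \<in> K. E s t}. 1)"
    proof (rule sum_mono)
      fix r assume "r \<in> {s \<in> K. E s t}"
      then show "card ({y. E r y \<and> y \<notin> K} - {t}) \<le> 1" using out2[of r] tK by simp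
    qed
    finally show ?thesis using few[OF t] by simp
  qed
  have cW: "card ({y. E w y} - T) \<le> 3"
  proof -
    have "T - M \<subseteq> {y. E w y} \<inter> T" using wM w sym by blast
    then have "card (T - M) \<le> card ({y. E w y} \<inter> T)" by (rule card_mono[rotated]) (simp add: fT)
    moreover have "card (T - M) \<ge> card T - card M"
      by (rule diff_card_le_card_Diff) (simp add: M_def fT)
    moreover have "card {y. E w y} = card ({y. E w y} \<inter> T) + card ({y. E w y} - T)"
      by (rule card_Int_Diff) simp
    ultimately show ?thesis using degree_le[OF wV] cM \<open>k \<le> card T\<close> by linarith
  qed
  have "card (insert z (insert b (c ` ({y. E w y} - T)))) \<le> 5"
    using card_image_le[of "{y. E w y} - T" c] cW by (simp add: card_insert_if)
  then have "\<not> {..<k} \<subseteq> insert z (insert b (c ` ({y. E w y} - T)))"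
    using card_mono[of "insert z (insert b (c ` ({y. E w y} - T)))" "{..<k}"] k_ge by auto
  then obtain g where g: "g < k" "g \<noteq> z" "g \<noteq> b" "\<And>y. E w y \<Longrightarrow> y \<notin> T \<Longrightarrow> c y \<noteq> g" by auto
  have "proper_on E k (insert w (V - K)) (c(w := g))"
  proof (rule proper_on_update[OF c0 g(1) sym irrefl])
    show "c y \<noteq> g" if "E w y" for y
      using g(2) g(4)[OF that] Tz[of y] by (cases "y \<in> T") simp_all
  qed
  moreover have "insert w (V - K) = V - K" using wV w(2) by blast
  ultimately have c': "proper_on E k (V - K) (c(w := g))" by simp
  have "(c(w := g)) r = z" if "r \<in> T" for r using Tz[OF that] that wT by auto
  then obtain y where y: "E t y" "y \<notin> K" "(c(w := g)) y = b"
    using boundary_colour_forced[OF K(1,2), folded T_def, OF c' _ z(1) t b] by blast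
  have "y \<noteq> w" using y(3) g(3) by auto
  then show False using wu[OF y(1,2)] y(3) by simp
qed

end

section \<open>From critical graphs to the chromatic number\<close>

lemma P5_free_colourable:
  assumes fin: "finite V" and EV: "\<And>x y. E x y \<Longrightarrow> x \<in> V" and sym: "\<And>x y. E x y \<Longrightarrow> E y x"
    and irrefl: "\<And>x. \<not> E x x"
    and no_P5: "\<And>a b c d e. \<lbrakk>E a b; E b c; E c d; E d e;
        \<not> E a c; \<not> E a d; \<not> E a e; \<not> E b d; \<not> E b e; \<not> E c e\<rbrakk> \<Longrightarrow> False"
    and degree_le: "\<And>x. x \<in> V \<Longrightarrow> card {y. E x y} \<le> k + 1"
    and clique_le: "\<And>K. K \<subseteq> V \<Longrightarrow> (\<And>x y. x \<in> K \<Longrightarrow> y \<in> K \<Longrightarrow> x \<noteq> y \<Longrightarrow> E x y) \<Longrightarrow> card K \<le> k"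
    and k_ge: "8 \<le> k"
  shows "\<exists>c. proper_on E k V c"
proof -
  have "\<exists>c. proper_on E k W c" if "W \<subseteq> V" for W
    using finite_subset[OF that fin] that
  proof (induction W rule: finite_psubset_induct)
    case (psubset W)
    show ?case
    proof (rule ccontr)
      assume non: "\<nexists>c. proper_on E k W c"
      define F where "F x y \<longleftrightarrow> E x y \<and> x \<in> W \<and> y \<in> W" for x y
      have same: "proper_on F k X c \<longleftrightarrow> proper_on E k X c" if "X \<subseteq> W" for X c
        using that unfolding proper_on_def F_def by blast
      have nE: "\<not> E x y" if "\<not> F x y" "x \<in> W" "y \<in> W" for x y using that unfolding F_def by blast
      interpret critical W F k
      proof
        show "finite W" by fact
        show "F x y \<Longrightarrow> x \<in> W" "\<not> F x x" for x y using irrefl unfolding F_def by blast+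
        show "F x y \<Longrightarrow> F y x" for x y using sym unfolding F_def by blast
        show False if "F a b" "F b c" "F c d" "F d e" "\<not> F a c" "\<not> F a d" "\<not> F a e"
          "\<not> F b d" "\<not> F b e" "\<not> F c e" for a b c d e
        proof -
          have "a \<in> W" "b \<in> W" "c \<in> W" "d \<in> W" "e \<in> W" "E a b" "E b c" "E c d" "E d e"
            using that unfolding F_def by blast+
          then show False using no_P5[of a b c d e] nE that by blast
        qed
        show "card {y. F x y} \<le> k + 1" if "x \<in> W" for x
        proof -
          have "{y. E x y} \<subseteq> V" using EV sym by blast
          then have "card {y. F x y} \<le> card {y. E x y}"
            using fin by (intro card_mono) (auto simp: F_def intro: finite_subset)
          also have "\<dots> \<le> k + 1" using degree_le that psubset.prems by blast
          finally show ?thesis .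
        qed
        show "card K \<le> k" if "K \<subseteq> W" "\<And>x y. x \<in> K \<Longrightarrow> y \<in> K \<Longrightarrow> x \<noteq> y \<Longrightarrow> F x y" for K
        proof (rule clique_le)
          show "K \<subseteq> V" using that psubset.prems by blast
          show "E x y" if "x \<in> K" "y \<in> K" "x \<noteq> y" for x y
            using \<open>\<And>x y. x \<in> K \<Longrightarrow> y \<in> K \<Longrightarrow> x \<noteq> y \<Longrightarrow> F x y\<close>[OF that] unfolding F_def by blast
        qed
        show "8 \<le> k" by (rule k_ge)
        show "\<not> proper_on F k W c" for c using non same by blast
        show "\<exists>c. proper_on F k (W - {x}) c" if "x \<in> W" for x
          using psubset.IH[of "W - {x}"] psubset.prems that same[of "W - {x}"] by blast
      qed
      show False by (rule critical_impossible)
    qed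
  qed
  then show ?thesis by blast
qed

lemma not_induced_free_path:
  fixes G :: "('a, 'b) pre_digraph"
  assumes nomulti: "nomulti_digraph G"
    and dist: "distinct xs" and len: "length xs = n" and sub: "set xs \<subseteq> verts G"
    and adj: "\<And>i j. i < n \<Longrightarrow> j < n \<Longrightarrow> (xs ! i \<rightarrow>\<^bsub>G\<^esub> xs ! j) \<longleftrightarrow> j = Suc i \<or> i = Suc j"
  shows "\<not> induced_free G (with_proj (path_graph n))"
proof -
  interpret nomulti_digraph G by (rule nomulti)
  define H where "H = G \<restriction> set xs"
  define idx where "idx = the_inv_into {..<n} ((!) xs)"
  have inj: "inj_on ((!) xs) {..<n}" using dist len by (auto simp: inj_on_def nth_eq_iff_index_eq)
  have set_xs: "set xs = (!) xs ` {..<n}" using len by (auto simp: set_conv_nth)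
  have idx: "idx (xs ! i) = i" if "i < n" for i
    unfolding idx_def using the_inv_into_f_f[OF inj] that by simp
  define f where "f = \<lparr>iso_verts = idx, iso_arcs = (\<lambda>a. (idx (tail G a), idx (head G a))),
    iso_head = snd, iso_tail = fst\<rparr>"
  have ind: "induced_subgraph H G" unfolding H_def using sub by (rule induced_induce)
  have wfH: "wf_digraph H" unfolding H_def by (rule wellformed_induce_subgraph)
  have simpsH: "verts H = set xs" "tail H = tail G" "head H = head G"
    "arcs H = {e \<in> arcs G. tail G e \<in> set xs \<and> head G e \<in> set xs}"
    unfolding H_def by (auto simp: induce_subgraph_def)
  have idx_inj: "inj_on idx (set xs)"
    unfolding inj_on_def set_xs using idx by auto
  have iso: "pre_digraph.digraph_isomorphism H f"
    unfolding pre_digraph.digraph_isomorphism_def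
  proof (intro conjI ballI)
    show "inj_on (iso_verts f) (verts H)" using idx_inj by (simp add: f_def simpsH)
    show "inj_on (iso_arcs f) (arcs H)"
    proof (rule inj_onI)
      fix a b assume "a \<in> arcs H" "b \<in> arcs H" "iso_arcs f a = iso_arcs f b"
      then show "a = b"
        using no_multi_arcs[of a b] inj_onD[OF idx_inj] by (auto simp: f_def simpsH arc_to_ends_def)
    qed
  qed (use wfH in \<open>auto simp: f_def simpsH\<close>)
  have "iso_arcs f ` arcs H = parcs (path_graph n)"
  proof (intro equalityI subsetI)
    fix p assume "p \<in> iso_arcs f ` arcs H"
    then obtain a where a: "a \<in> arcs G" "tail G a \<in> set xs" "head G a \<in> set xs"
      "p = (idx (tail G a), idx (head G a))" by (auto simp: f_def simpsH)
    then obtain i j where ij: "i < n" "j < n" "tail G a = xs ! i" "head G a = xs ! j"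
      unfolding set_xs by auto
    then have "xs ! i \<rightarrow>\<^bsub>G\<^esub> xs ! j" using a(1) by (metis arc_to_ends_def dominatesI)
    then show "p \<in> parcs (path_graph n)" using adj ij a(4) idx by (auto simp: path_graph_def)
  next
    fix p assume "p \<in> parcs (path_graph n)"
    then obtain i j where p: "p = (i, j)" "i < n" "j < n" "j = Suc i \<or> i = Suc j"
      by (auto simp: path_graph_def)
    then have "xs ! i \<rightarrow>\<^bsub>G\<^esub> xs ! j" using adj by simp
    then obtain a where "a \<in> arcs G" "tail G a = xs ! i" "head G a = xs ! j"
      by (auto simp: arcs_ends_conv)
    then show "p \<in> iso_arcs f ` arcs H"
      using p idx set_xs by (auto simp: f_def simpsH intro!: rev_image_eqI[of a])
  qed
  moreover have "iso_verts f ` verts H = {..<n}"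
    using idx by (force simp: f_def simpsH set_xs image_image)
  ultimately have "with_proj (path_graph n) = app_iso f H"
    by (simp add: app_iso_def with_proj_def f_def path_graph_def)
  then show ?thesis using ind iso unfolding induced_free_def digraph_iso_def by metis
qed

lemma induced_free_path5:
  fixes G :: "('a, 'b) pre_digraph"
  assumes "graph G" and free: "induced_free G (with_proj (path_graph 5))"
    and E: "E = (\<lambda>x y. x \<rightarrow>\<^bsub>G\<^esub> y)"
    and e: "E a b" "E b c" "E c d" "E d e"
    and n: "\<not> E a c" "\<not> E a d" "\<not> E a e" "\<not> E b d" "\<not> E b e" "\<not> E c e"
  shows False
proof -
  interpret graph G by fact
  have sym: "E x y \<longleftrightarrow> E y x" for x y unfolding E using arcs_ends_symmetric[OF sym_arcs] by blast
  have irrefl: "\<not> E x x" for x unfolding E using no_loops by (auto simp: arcs_ends_conv)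
  have V: "x \<in> verts G" "y \<in> verts G" if "E x y" for x y using that unfolding E by (auto simp: arcs_ends_conv)
  let ?xs = "[a, b, c, d, e]"
  have "distinct ?xs" using e n sym irrefl by auto
  moreover have "(?xs ! i \<rightarrow>\<^bsub>G\<^esub> ?xs ! j) \<longleftrightarrow> j = Suc i \<or> i = Suc j" if "i < 5" "j < 5" for i j
  proof -
    have "i \<in> {0, 1, 2, 3, 4}" "j \<in> {0, 1, 2, 3, 4}" using that by auto
    moreover have "E b a" "E c b" "E d c" "E e d" "\<not> E c a" "\<not> E d a" "\<not> E e a" "\<not> E d b" "\<not> E e b" "\<not> E e c"
      using e n sym by blast+
    ultimately have "E (?xs ! i) (?xs ! j) \<longleftrightarrow> j = Suc i \<or> i = Suc j"
      using e n irrefl by (elim insertE emptyE) simp_all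
    then show ?thesis unfolding E .
  qed
  ultimately show False
    using not_induced_free_path[of G ?xs 5] free V e nomulti_digraph by auto
qed

theorem mainTheorem4:
  fixes G :: "('a, 'b) pre_digraph"
  assumes "graph G"
    and "induced_free G (with_proj (path_graph 5))"
    and "max_degree G \<ge> 9"
  shows "chromatic_number G \<le> max (max_degree G - 1) (clique_number G)"
proof -
  interpret graph G by fact
  define k where "k = max (max_degree G - 1) (clique_number G)"
  define E where "E = (\<lambda>x y. x \<rightarrow>\<^bsub>G\<^esub> y)"
  have EV: "x \<in> verts G" if "E x y" for x y using that unfolding E_def by (auto simp: arcs_ends_conv)
  have "\<exists>c. proper_on E k (verts G) c"
  proof (rule P5_free_colourable)
    show "E x y \<Longrightarrow> E y x" for x y unfolding E_def by (rule arcs_ends_symmetric[OF sym_arcs])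
    show "\<not> E x x" for x unfolding E_def using no_loops by (auto simp: arcs_ends_conv)
    show "False" if "E a b" "E b c" "E c d" "E d e"
      "\<not> E a c" "\<not> E a d" "\<not> E a e" "\<not> E b d" "\<not> E b e" "\<not> E c e" for a b c d e
      using induced_free_path5[OF assms(1,2) E_def that] .
    show "card {y. E x y} \<le> k + 1" if "x \<in> verts G" for x
    proof -
      have "{y. E x y} = head G ` out_arcs G x" unfolding E_def by (auto simp: arcs_ends_conv out_arcs_def)
      then have "card {y. E x y} \<le> out_degree G x" 
        unfolding out_degree_def using card_image_le[OF finite_out_arcs, of "head G" x] by simp
      also have "\<dots> \<le> max_degree G" using that unfolding max_degree_def by (intro Max_ge) auto
      finally show ?thesis unfolding k_def by simp
    qed
    show "card K \<le> k" if "K \<subseteq> verts G" "\<And>x y. x \<in> K \<Longrightarrow> y \<in> K \<Longrightarrow> x \<noteq> y \<Longrightarrow> E x y" for K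
    proof -
      have "finite {K. clique G K}"
        by (rule finite_subset[of _ "Pow (verts G)"]) (auto simp: clique_def)
      moreover have "clique G K" using that unfolding clique_def E_def by blast
      ultimately have "card K \<le> clique_number G" unfolding clique_number_def by (intro Max_ge) auto
      then show ?thesis unfolding k_def by simp
    qed
    show "8 \<le> k" using assms(3) unfolding k_def by simp
  qed (use EV in auto)
  then obtain c where c: "proper_on E k (verts G) c" by blast
  have "E y x" if "E x y" for x y using that unfolding E_def by (rule arcs_ends_symmetric[OF sym_arcs])
  then have "proper_colouring G k c"
    using c EV unfolding proper_on_def proper_colouring_def E_def by blast
  then show ?thesis unfolding chromatic_number_def k_def[symmetric] by (intro Least_le) blast
qed

end
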